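(* Let $k$ be a field of characteristic $p>0$, let $C_p$ be the cyclic group of order $p$, and let $M$ and $N$ be finitely generated $kC_p$-modules. Then $$\operatorname{ppdim}(M\oplus N)=\max\{\operatorname{ppdim}(M),\operatorname{ppdim}(N)\}.$$
   Context: All modules are finitely generated. Let $G$ be a finite group. A $kG$-module is a permutation module if it admits a $G$-invariant $k$-basis; it is a $p$-permutation module if it is a direct summand of a permutation module. For $G=C_p$ these two notions coincide. A $p$-permutation resolution of a $kG$-module $M$ of length $s$ is an exact complex $0\to P_s\to P_{s-1}\to\cdots\to P_0\to M\to 0$ of $kG$-modules in which all $P_i$ are $p$-permutation modules; $\operatorname{ppdim}(M)$ is the minimal length of all $p$-permutation resolutions of $M$ (every $M$ is known to admit one of finite length). *)

theory Defs
  imports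
    "HOL-Algebra.Elementary_Groups"
    "HOL-Library.Poly_Mapping"
    "HOL-Library.Product_Plus"
    "HOL-Library.Extended_Nat"
begin

text \<open>
  A module over the group algebra \<open>kG\<close> is a \<open>k\<close>-vector space together with a \<open>k\<close>-linear action
  of \<open>G\<close>. The underlying vector space is a subspace, the carrier, of a vector space on a full type;
  the action is only meaningful on the carrier, for group elements in the carrier of \<open>G\<close>.
\<close>

record ('k, 'g, 'v) kgmod = "'v partial_object" +
  scal :: "'k \<Rightarrow> 'v \<Rightarrow> 'v"
  act :: "'g \<Rightarrow> 'v \<Rightarrow> 'v"

definition kG_module ::
  "('g, 'z) monoid_scheme \<Rightarrow> ('k::field, 'g, 'v::ab_group_add) kgmod \<Rightarrow> bool"
  where "kG_module G M \<longleftrightarrow>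
    group G \<and> finite (carrier G) \<and>
    vector_space (scal M) \<and> module.subspace (scal M) (carrier M) \<and>
    (\<forall>g\<in>carrier G. \<forall>v\<in>carrier M. act M g v \<in> carrier M) \<and>
    (\<forall>g\<in>carrier G. \<forall>v\<in>carrier M. \<forall>w\<in>carrier M. act M g (v + w) = act M g v + act M g w) \<and>
    (\<forall>g\<in>carrier G. \<forall>c. \<forall>v\<in>carrier M. act M g (scal M c v) = scal M c (act M g v)) \<and>
    (\<forall>v\<in>carrier M. act M \<one>\<^bsub>G\<^esub> v = v) \<and>
    (\<forall>g\<in>carrier G. \<forall>h\<in>carrier G. \<forall>v\<in>carrier M.
       act M (g \<otimes>\<^bsub>G\<^esub> h) v = act M g (act M h v))"

text \<open>The \<open>kG\<close>-submodule generated by \<open>S\<close> is the \<open>k\<close>-span of the \<open>G\<close>-orbits of the elements of \<open>S\<close>.\<close>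

definition fg_kG_module ::
  "('g, 'z) monoid_scheme \<Rightarrow> ('k::field, 'g, 'v::ab_group_add) kgmod \<Rightarrow> bool"
  where "fg_kG_module G M \<longleftrightarrow> kG_module G M \<and>
    (\<exists>S. finite S \<and> S \<subseteq> carrier M \<and>
      carrier M = module.span (scal M) {act M g s | g s. g \<in> carrier G \<and> s \<in> S})"

definition kG_hom ::
  "('g, 'z) monoid_scheme \<Rightarrow> ('k, 'g, 'v::ab_group_add) kgmod \<Rightarrow>
    ('k, 'g, 'w::ab_group_add) kgmod \<Rightarrow> ('v \<Rightarrow> 'w) set"
  where "kG_hom G M N = {f. (\<forall>v\<in>carrier M. f v \<in> carrier N) \<and>
    (\<forall>v\<in>carrier M. \<forall>w\<in>carrier M. f (v + w) = f v + f w) \<and>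
    (\<forall>c. \<forall>v\<in>carrier M. f (scal M c v) = scal N c (f v)) \<and>
    (\<forall>g\<in>carrier G. \<forall>v\<in>carrier M. f (act M g v) = act N g (f v))}"

definition direct_sum ::
  "('k, 'g, 'v) kgmod \<Rightarrow> ('k, 'g, 'w) kgmod \<Rightarrow> ('k, 'g, 'v \<times> 'w) kgmod"
  where "direct_sum M N =
    \<lparr>carrier = carrier M \<times> carrier N,
     scal = (\<lambda>c (v, w). (scal M c v, scal N c w)),
     act = (\<lambda>g (v, w). (act M g v, act N g w))\<rparr>"

definition permutation_module ::
  "('g, 'z) monoid_scheme \<Rightarrow> ('k::field, 'g, 'v::ab_group_add) kgmod \<Rightarrow> bool"
  where "permutation_module G M \<longleftrightarrow> fg_kG_module G M \<and>
    (\<exists>B\<subseteq>carrier M. \<not> module.dependent (scal M) B \<and> module.span (scal M) B = carrier M \<and>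
      (\<forall>g\<in>carrier G. \<forall>b\<in>B. act M g b \<in> B))"

text \<open>
  HOL cannot quantify over types inside a formula, so modules under an existential quantifier live
  on the type \<^typ>\<open>nat \<Rightarrow>\<^sub>0 'k\<close>. This loses nothing: finitely generated modules over the group
  algebra of a finite group are finite-dimensional, and \<^typ>\<open>nat \<Rightarrow>\<^sub>0 'k\<close>, as the space of
  finitely supported sequences, has subspaces of every finite dimension.
\<close>

type_synonym ('k, 'g) small_kgmod = "('k, 'g, nat \<Rightarrow>\<^sub>0 'k) kgmod"

definition p_permutation_module ::
  "('g, 'z) monoid_scheme \<Rightarrow> ('k::field, 'g, 'v::ab_group_add) kgmod \<Rightarrow> bool"
  where "p_permutation_module G M \<longleftrightarrow> fg_kG_module G M \<and>
    (\<exists>Q :: ('k, 'g) small_kgmod. fg_kG_module G Q \<and> permutation_module G (direct_sum M Q))"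

text \<open>
  A complex \<open>0 \<rightarrow> P\<^sub>s \<rightarrow> \<dots> \<rightarrow> P\<^sub>0 \<rightarrow> M \<rightarrow> 0\<close> is encoded by an infinite sequence \<open>P\<close> that vanishes
  beyond \<open>s\<close>, with differentials \<open>d i\<close> from \<open>P (Suc i)\<close> to \<open>P i\<close> and augmentation \<open>e\<close>; exactness at
  the left end, including injectivity of \<open>e\<close> for \<open>s = 0\<close>, is then an instance of the general
  conditions.
\<close>

definition p_permutation_resolution ::
  "('g, 'z) monoid_scheme \<Rightarrow> ('k::field, 'g, 'v::ab_group_add) kgmod \<Rightarrow> nat \<Rightarrow>
    (nat \<Rightarrow> ('k, 'g) small_kgmod) \<Rightarrow> (nat \<Rightarrow> (nat \<Rightarrow>\<^sub>0 'k) \<Rightarrow> (nat \<Rightarrow>\<^sub>0 'k)) \<Rightarrow>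
    ((nat \<Rightarrow>\<^sub>0 'k) \<Rightarrow> 'v) \<Rightarrow> bool"
  where "p_permutation_resolution G M s P d e \<longleftrightarrow>
    (\<forall>i. p_permutation_module G (P i)) \<and>
    (\<forall>i>s. carrier (P i) = {0}) \<and>
    (\<forall>i. d i \<in> kG_hom G (P (Suc i)) (P i)) \<and>
    e \<in> kG_hom G (P 0) M \<and>
    e ` carrier (P 0) = carrier M \<and>
    {x \<in> carrier (P 0). e x = 0} = d 0 ` carrier (P 1) \<and>
    (\<forall>i. {x \<in> carrier (P (Suc i)). d i x = 0} = d (Suc i) ` carrier (P (Suc (Suc i))))"

definition ppdim ::
  "('g, 'z) monoid_scheme \<Rightarrow> ('k::field, 'g, 'v::ab_group_add) kgmod \<Rightarrow> enat"
  where "ppdim G M = Inf {enat s | s. \<exists>P d e. p_permutation_resolution G M s P d e}"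

end

theory Submission
  imports
    "HOL-Algebra.Multiplicative_Group"
    Defs
    "HOL-Computational_Algebra.Polynomial"
    "HOL-Computational_Algebra.Primes"
begin

text \<open>
  Let \<open>g\<close> generate \<open>G\<close> and put \<open>x = g - 1\<close>, so that \<open>x^p = 0\<close> on every module. The condition
  \<open>gap a b\<close>, that \<open>x^(a+1) m = 0\<close> implies \<open>x^a m \<in> x^(p-b-1) M\<close>, says that \<open>M\<close> has no Jordan block
  of size strictly between \<open>a\<close> and \<open>p - b\<close>, and it visibly holds for \<open>M \<oplus> N\<close> iff it holds for both summands.
  It therefore suffices to show that \<open>M\<close> has a resolution of length \<open>s\<close> iff it satisfies
  \<open>gap a b\<close> for \<open>a = s div 2 + 1\<close> and \<open>b = (s + 1) div 2\<close>.

  For \<open>s = 0\<close> this is the description of permutation modules as sums of free and trivial modules.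
  Passing from \<open>s + 1\<close> to \<open>s\<close> replaces \<open>(a, b)\<close> by \<open>(b, a - 1)\<close>: if \<open>K\<close> is the kernel of a
  surjection from a permutation module to \<open>M\<close> and \<open>K\<close> satisfies \<open>gap b (a - 1)\<close>, then \<open>M\<close>
  satisfies \<open>gap a b\<close>. The converse holds when the permutation module is the sum of a free cover of
  \<open>M\<close> and of a complement of \<open>x^a M \<inter> ker x\<close> in \<open>ker x\<close>, the latter with trivial action.
\<close>

section \<open>Nilpotent operators with a gap in the sizes of their Jordan blocks\<close>

text \<open>The gap arguments are purely additive, so an abelian group with a nilpotent endomorphism
  is the right setting. Kernels of equivariant maps are again instances, with the same operator and
  the same \<open>p\<close>.\<close>

locale nilpotent_group =
  fixes V :: "'v::ab_group_add set" and x :: "'v \<Rightarrow> 'v" and p :: nat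
  assumes zero_closed [simp]: "0 \<in> V"
    and diff_closed [simp]: "u \<in> V \<Longrightarrow> v \<in> V \<Longrightarrow> u - v \<in> V"
    and op_closed: "v \<in> V \<Longrightarrow> x v \<in> V"
    and op_diff: "u \<in> V \<Longrightarrow> v \<in> V \<Longrightarrow> x (u - v) = x u - x v"
    and op_nilpotent: "v \<in> V \<Longrightarrow> (x ^^ p) v = 0"
begin

lemma minus_closed [simp]: "v \<in> V \<Longrightarrow> - v \<in> V"
  using diff_closed[OF zero_closed, of v] by simp

lemma add_closed [simp]: "u \<in> V \<Longrightarrow> v \<in> V \<Longrightarrow> u + v \<in> V"
  using diff_closed[of u "- v"] by simp

lemma funpow_closed [simp]: "v \<in> V \<Longrightarrow> (x ^^ n) v \<in> V"
  by (induction n) (auto simp: op_closed)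

lemma funpow_diff: "u \<in> V \<Longrightarrow> v \<in> V \<Longrightarrow> (x ^^ n) (u - v) = (x ^^ n) u - (x ^^ n) v"
  by (induction n) (auto simp: op_diff)

lemma funpow_zero [simp]: "(x ^^ n) 0 = 0"
  using funpow_diff[of 0 0 n] by simp

lemma funpow_minus: "v \<in> V \<Longrightarrow> (x ^^ n) (- v) = - (x ^^ n) v"
  using funpow_diff[of 0 v n] by simp

lemma funpow_add_arg: "u \<in> V \<Longrightarrow> v \<in> V \<Longrightarrow> (x ^^ n) (u + v) = (x ^^ n) u + (x ^^ n) v"
  using funpow_diff[of u "- v" n] by (simp add: funpow_minus)

lemma funpow_funpow: "(x ^^ m) ((x ^^ n) v) = (x ^^ (m + n)) v"
  by (simp add: funpow_add)

lemma funpow_eq_zero: "v \<in> V \<Longrightarrow> (x ^^ m) v = 0 \<Longrightarrow> m \<le> n \<Longrightarrow> (x ^^ n) v = 0"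
  using funpow_funpow[of "n - m" m v] by simp

lemma funpow_ge_nilpotent: "v \<in> V \<Longrightarrow> p \<le> n \<Longrightarrow> (x ^^ n) v = 0"
  using funpow_eq_zero op_nilpotent by blast

text \<open>In a Jordan block of size j > a, the vectors \<open>(x ^^ a) m\<close> with
  \<open>(x ^^ Suc a) m = 0\<close> fill the socle, which lies in the image of x^(p-b-1) exactly if
  j >= p - b. Blocks of size at most a satisfy the condition because x^a vanishes on them.\<close>

definition gap :: "nat \<Rightarrow> nat \<Rightarrow> bool"
  where "gap a b \<longleftrightarrow>
    (\<forall>m\<in>V. (x ^^ Suc a) m = 0 \<longrightarrow> (\<exists>m'\<in>V. (x ^^ a) m = (x ^^ (p - b - 1)) m'))"

text \<open>Here p - b - 1 \<le> a, so x^a factors through x^(p-b-1).\<close>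

lemma gap_trivial: "p \<le> Suc (a + b) \<Longrightarrow> gap a b"
  unfolding gap_def
proof (intro ballI impI)
  fix m assume "p \<le> Suc (a + b)" "m \<in> V"
  then have "(x ^^ a) m = (x ^^ (p - b - 1)) ((x ^^ (a - (p - b - 1))) m)"
    by (simp add: funpow_funpow)
  then show "\<exists>m'\<in>V. (x ^^ a) m = (x ^^ (p - b - 1)) m'"
    using \<open>m \<in> V\<close> funpow_closed by blast
qed

text \<open>This is the inclusion of ker x^n in ker x^a + x^(p-b-n) V: a block that x^a does not
  kill has size at least p - b, and there ker x^n consists of multiples of x^(p-b-n). The induction
  lowers the exponent n by one with each use of the gap.\<close>

lemma gap_descent:
  assumes gap: "gap a b" and "a \<le> n" "n < p - b" "m \<in> V" "(x ^^ n) m = 0"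
  shows "\<exists>z\<in>V. (x ^^ a) (m - (x ^^ (p - b - n)) z) = 0"
  using assms(2-)
proof (induction n arbitrary: m rule: dec_induct)
  case base
  then show ?case by (intro bexI[of _ 0]) auto
next
  case (step n)
  \<comment> \<open>The gap is applied to x^(n-a) m, which x^(a+1) kills and which x^a sends to x^n
    m.\<close>
  have *: "(x ^^ Suc a) ((x ^^ (n - a)) m) = 0" "(x ^^ a) ((x ^^ (n - a)) m) = (x ^^ n) m"
    using step.hyps step.prems by (simp_all only: funpow_funpow) simp_all
  then obtain m' where m': "m' \<in> V" "(x ^^ n) m = (x ^^ (p - b - 1)) m'"
    using gap step.prems(2) unfolding gap_def by (metis funpow_closed)
  \<comment> \<open>With this k, x^n maps x^k m' to x^(p-b-1) m' = x^n m, so subtracting x^k m'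
    leaves a vector killed by x^n.\<close>
  define k where "k = p - b - Suc n"
  have k: "p - b - 1 = n + k" "p - b - n = Suc k"
    using step.prems unfolding k_def by auto
  have "(x ^^ n) (m - (x ^^ k) m') = 0"
    using m' step.prems(2) by (simp add: funpow_diff funpow_funpow k[simplified])
  then obtain z where z: "z \<in> V" "(x ^^ a) (m - (x ^^ k) m' - (x ^^ Suc k) z) = 0"
    using step.IH[of "m - (x ^^ k) m'"] step.prems m'(1) k(2) by auto
  \<comment> \<open>The correction supplied by the induction carries one more factor x, so both
    corrections merge into a multiple of x^k.\<close>
  have "m - (x ^^ k) (m' + x z) = m - (x ^^ k) m' - (x ^^ Suc k) z"
    using z(1) m'(1) by (simp add: funpow_add_arg op_closed funpow_swap1)
  then show ?case
    using z m'(1) unfolding k_def[symmetric] by (metis add_closed op_closed)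
qed

end

section \<open>Passing between a module and the kernel of a surjection onto it\<close>

locale nilpotent_epi =
  P: nilpotent_group P x p + M: nilpotent_group M y p
  for P :: "'v::ab_group_add set" and x and M :: "'w::ab_group_add set" and y and p +
  fixes e :: "'v \<Rightarrow> 'w"
  assumes epi: "e ` P = M"
    and hom_diff: "u \<in> P \<Longrightarrow> v \<in> P \<Longrightarrow> e (u - v) = e u - e v"
    and hom_op: "v \<in> P \<Longrightarrow> e (x v) = y (e v)"
    and gap_P: "P.gap 1 0"
begin

lemma hom_closed [simp]: "v \<in> P \<Longrightarrow> e v \<in> M"
  using epi by blast

lemma hom_zero [simp]: "e 0 = 0"
  using hom_diff[of 0 0] by simp

lemma hom_minus: "v \<in> P \<Longrightarrow> e (- v) = - e v"
  using hom_diff[of 0 v] by simp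

lemma hom_add: "u \<in> P \<Longrightarrow> v \<in> P \<Longrightarrow> e (u + v) = e u + e v"
  using hom_diff[of u "- v"] by (simp add: hom_minus)

lemma hom_funpow: "v \<in> P \<Longrightarrow> e ((x ^^ n) v) = (y ^^ n) (e v)"
  by (induction n) (auto simp: hom_op)

sublocale K: nilpotent_group "{v \<in> P. e v = 0}" x p
  by unfold_locales
    (auto simp: hom_diff hom_op P.op_diff P.op_closed P.op_nilpotent M.funpow_zero[of 1, simplified])

text \<open>A vector m killed by y^(a+1) is lifted to q, and x^(a+1) q falls into the kernel. The
  gap of the kernel changes x^(a-1) q by a kernel element into a vector killed by x^(b+2); since P
  has only blocks of size 1 and p, x times this vector is a multiple of x^(p-b-1). Its image is y^a
  m.\<close>

lemma gap_from_kernel: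
  assumes "a \<ge> 1" and gap_K: "K.gap b (a - 1)"
  shows "M.gap a b"
proof (cases "p \<le> Suc (a + b)")
  case True
  then show ?thesis by (rule M.gap_trivial)
next
  case False
  show ?thesis unfolding M.gap_def
  proof (intro ballI impI)
    fix m assume m: "m \<in> M" "(y ^^ Suc a) m = 0"
    obtain q where q: "q \<in> P" "e q = m" using m epi by blast
    let ?u = "(x ^^ Suc a) q"
    have u: "?u \<in> {v \<in> P. e v = 0}"
      using q m hom_funpow[of q "Suc a"] P.funpow_closed[of q "Suc a"] by auto
    have "(x ^^ (p - a - 1)) ?u = 0"
      using q False by (simp only: P.funpow_funpow) (simp add: P.funpow_ge_nilpotent)
    \<comment> \<open>The exponent 2 makes the correction x^2 k comparable with x^(a+1) q = x^2
      (x^(a-1) q).\<close>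
    moreover have "p - (a - 1) - (p - a - 1) = 2"
      using False assms by linarith
    moreover have "b \<le> p - a - 1" "p - a - 1 < p - (a - 1)"
      using False assms by linarith+
    ultimately obtain k where k: "k \<in> P" "e k = 0" "(x ^^ b) (?u - (x ^^ 2) k) = 0"
      using K.gap_descent[OF gap_K, of "p - a - 1" ?u] u by auto
    obtain a' where a': "a = Suc a'" using assms by (cases a) auto
    \<comment> \<open>Here \<open>a'\<close> is a - 1, and x^2 v is the difference that x^b
      kills.\<close>
    define v where "v = (x ^^ a') q - k"
    have v: "v \<in> P" using q k by (simp add: v_def)
    have xv: "x v = (x ^^ a) q - x k"
      using q k by (simp add: v_def P.op_diff a')
    have "?u - (x ^^ 2) k = x (x v)"
      unfolding xv using q k P.funpow_closed[OF q(1), of a]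
      by (simp add: P.op_diff P.op_closed eval_nat_numeral)
    then have "(x ^^ (b + 2)) v = 0"
      using k by (simp add: funpow_swap1)
    then obtain z where z: "z \<in> P" "x (v - (x ^^ (p - (b + 2))) z) = 0"
      using P.gap_descent[OF gap_P, of "b + 2" v] v False assms by auto
    have "x v = (x ^^ (p - b - 1)) z"
    proof -
      have "p - b - 1 = Suc (p - (b + 2))" using False by simp
      then show ?thesis using z v by (simp add: P.op_diff)
    qed
    then have "e (x v) = (y ^^ (p - b - 1)) (e z)"
      using z hom_funpow by simp
    \<comment> \<open>The summand k of v is invisible here because \<open>e k = 0\<close>.\<close>
    moreover have "e (x v) = (y ^^ a) m"
      unfolding xv using q k
      by (simp add: hom_diff hom_funpow hom_op P.op_closed M.funpow_zero[of 1, simplified])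
    ultimately show "\<exists>m'\<in>M. (y ^^ a) m = (y ^^ (p - b - 1)) m'"
      using z hom_closed by auto
  qed
qed

text \<open>The hypotheses \<open>H1\<close> and \<open>H2\<close> express that the fixed vectors of
  P cover those of M efficiently: modulo y^a M they hit every fixed vector, and one that lands in
  y^a M already lands in y^(p-1) M. The proof peels a fixed vector off w and then alters the rest by
  terms that x^(p-1) kills, until a power of x can be split off inside the kernel.\<close>

lemma gap_kernel:
  assumes "a \<ge> 1" "b \<ge> 1" and gap_M: "M.gap a b"
    and H1: "\<And>r. a < p \<Longrightarrow> r \<in> P \<Longrightarrow> x r = 0 \<Longrightarrow> e r \<in> (y ^^ a) ` M \<Longrightarrow> e r \<in> (y ^^ (p - 1)) ` M"
    and H2: "\<And>m. m \<in> M \<Longrightarrow> y m = 0 \<Longrightarrow> \<exists>r\<in>P. \<exists>m'\<in>M. x r = 0 \<and> m = e r + (y ^^ a) m'"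
  shows "K.gap b (a - 1)"
proof (cases "p \<le> Suc (b + (a - 1))")
  case True
  then show ?thesis by (rule K.gap_trivial)
next
  case False
  have ab: "a + b < p" using False assms by simp
  show ?thesis unfolding K.gap_def
  proof (intro ballI impI)
    fix w assume w: "w \<in> {v \<in> P. e v = 0}" and xw: "(x ^^ Suc b) w = 0"
    \<comment> \<open>As P has blocks of size 1 and p only, w is a fixed vector plus a multiple of
      x^(p-b-1).\<close>
    obtain f where f: "f \<in> P" "x (w - (x ^^ (p - b - 1)) f) = 0"
      using P.gap_descent[OF gap_P, of "Suc b" w] w xw ab assms by auto
    define r where "r = w - (x ^^ (p - b - 1)) f"
    have r: "r \<in> P" "x r = 0" using f w by (auto simp: r_def)
    have er: "e r = - (y ^^ (p - b - 1)) (e f)"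
      using f w by (simp add: r_def hom_diff hom_funpow)
    have "e r = (y ^^ a) (- (y ^^ (p - b - 1 - a)) (e f))"
      using ab f by (simp add: er M.funpow_minus M.funpow_funpow)
    then have "e r \<in> (y ^^ (p - 1)) ` M"
      using f r ab by (intro H1) auto
    then obtain f0 where f0: "f0 \<in> P" "e r = (y ^^ (p - 1)) (e f0)"
      using epi by auto
    \<comment> \<open>The summand x^b f0 cancels the image of r, so that y^(p-b-1) kills
      \<open>e f'\<close>. As b \<ge> 1, it does not change x^(p-1) f.\<close>
    define f' where "f' = f + (x ^^ b) f0"
    have f': "f' \<in> P" using f f0 by (simp add: f'_def)
    have "(y ^^ (p - b - 1)) (e f') = (y ^^ (p - b - 1)) (e f) + (y ^^ (p - 1)) (e f0)"
      using f f0 ab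
      by (simp add: f'_def hom_add hom_funpow M.funpow_add_arg M.funpow_funpow)
    then have "(y ^^ (p - b - 1)) (e f') = 0"
      using f0(2) er by (metis add.right_inverse)
    moreover have "p - b - (p - b - 1) = 1" "a \<le> p - b - 1" "p - b - 1 < p - b"
      using ab by linarith+
    ultimately obtain z where z: "z \<in> M" "(y ^^ a) (e f' - y z) = 0"
      using M.gap_descent[OF gap_M, of "p - b - 1" "e f'"] f' by auto
    have a: "a = Suc (a - 1)" using assms by simp
    have "(y ^^ Suc (a - 1)) (e f' - y z) = 0"
      using z(2) a by simp
    then have "y ((y ^^ (a - 1)) (e f' - y z)) = 0" by simp
    \<comment> \<open>The vector y^(a-1) (e f' - y z) is fixed by the choice of z, so
      \<open>H2\<close> applies to it.\<close>
    then obtain r' m' where rm: "r' \<in> P" "m' \<in> M" "x r' = 0"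
      "(y ^^ (a - 1)) (e f' - y z) = e r' + (y ^^ a) m'"
      using H2[of "(y ^^ (a - 1)) (e f' - y z)"] f' z by (auto simp: M.op_closed)
    obtain h where h: "h \<in> P" "e h = z + m'"
      using epi z rm by (metis M.add_closed imageE)
    \<comment> \<open>The lift h of z + m' removes y^a z and y^a m' at once, and r' removes what
      remains, so \<open>e k = 0\<close>.\<close>
    define k where "k = (x ^^ (a - 1)) (f' - x h) - r'"
    have y_add: "y (z + m') = y z + y m'"
      using M.funpow_add_arg[of z m' 1] z rm by simp
    have "(y ^^ a) m' = (y ^^ (a - 1)) (y m')"
      using a by (metis funpow_Suc_right o_apply)
    then have "e k = 0"
      using f' h rm z y_add
      by (simp add: k_def hom_diff hom_funpow hom_op P.op_closed M.op_closed M.funpow_diff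
          M.funpow_add_arg algebra_simps)
    moreover have k: "k \<in> P"
      using f' h rm by (simp add: k_def P.op_closed)
    \<comment> \<open>Each correction disappears in turn: r under x^b, x^b f0 and x h under x^(p-1),
      and r' under x^(p-a), where p - a is positive.\<close>
    moreover have "(x ^^ b) w = (x ^^ (p - (a - 1) - 1)) k"
    proof -
      have "(x ^^ b) w = (x ^^ b) r + (x ^^ (p - 1)) f"
        using r f w ab P.funpow_add_arg[of r "(x ^^ (p - b - 1)) f" b]
        by (simp add: r_def P.funpow_funpow)
      also have "(x ^^ b) r = 0"
        using P.funpow_eq_zero[of r 1 b] r assms by simp
      also have "0 + (x ^^ (p - 1)) f = (x ^^ (p - 1)) f'"
        using f f0 assms ab
        by (simp add: f'_def P.funpow_add_arg P.funpow_funpow P.funpow_ge_nilpotent)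
      also have "\<dots> = (x ^^ (p - 1)) (f' - x h)"
      proof -
        have "(x ^^ (p - 1)) (x h) = (x ^^ Suc (p - 1)) h" by (simp only: funpow_Suc_right o_apply)
        also have "\<dots> = 0" using h by (intro P.funpow_ge_nilpotent) auto
        finally show ?thesis using h f' by (simp add: P.funpow_diff P.op_closed)
      qed
      also have "\<dots> = (x ^^ (p - (a - 1) - 1)) ((x ^^ (a - 1)) (f' - x h))"
        using ab by (simp add: P.funpow_funpow)
      also have "\<dots> = (x ^^ (p - (a - 1) - 1)) k"
        using f' h rm ab assms P.funpow_eq_zero[of r' 1 "p - (a - 1) - 1"]
        by (simp add: k_def P.funpow_diff P.op_closed)
      finally show ?thesis .
    qed
    ultimately show "\<exists>m'\<in>{v \<in> P. e v = 0}. (x ^^ b) w = (x ^^ (p - (a - 1) - 1)) m'"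
      by blast
  qed
qed

end

section \<open>Modules over the group algebra of a cyclic group of prime order\<close>

text \<open>In characteristic p, (X - 1)^p = X^p - 1, and cancelling X - 1 gives (X - 1)^(p-1) = 1 +
  X + ... + X^(p-1). Evaluated at the generator, the first becomes nilpotency of g - 1 and the
  second identifies the norm element.\<close>

lemma coeff_linear_pow_char:
  assumes "CHAR('k::field) = p" "p > 0"
  shows "i \<le> p \<Longrightarrow> coeff ([:- 1, 1 :: 'k:] ^ p) i = (if i = p then 1 else if i = 0 then -1 else 0)"
    and "i < p \<Longrightarrow> coeff ([:- 1, 1 :: 'k:] ^ (p - 1)) i = 1"
proof -
  let ?X = "[:0, 1 :: 'k:]"
  have prime: "prime (CHAR('k poly))"
    using assms prime_CHAR_semidom[where 'a = 'k] by simp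
  have X: "[:- 1, 1 :: 'k:] = ?X - 1" by (simp add: one_pCons)
  have X_pow: "?X ^ n = monom 1 n" for n by (simp add: monom_altdef)
  have ne: "?X - 1 \<noteq> 0" unfolding X[symmetric] by simp
  have "(?X - 1) ^ p + 1 = ((?X - 1) + 1) ^ p"
    using freshmans_dream[of p "?X - 1" 1, OF prime] assms by (simp only: semiring_char_poly power_one)
  then have eq: "(?X - 1) ^ p = ?X ^ p - 1" by (simp only: diff_add_cancel eq_diff_eq)
  show "i \<le> p \<Longrightarrow> coeff ([:- 1, 1 :: 'k:] ^ p) i = (if i = p then 1 else if i = 0 then -1 else 0)"
    unfolding X eq X_pow using assms(2) by (simp add: coeff_1)
  have "(?X - 1) * (?X - 1) ^ (p - 1) = (?X - 1) ^ p"
    using assms(2) power_Suc[of "?X - 1" "p - 1"] by (simp only: Suc_diff_1)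
  also have "\<dots> = (?X - 1) * (\<Sum>i<p. ?X ^ i)"
    unfolding eq by (rule power_diff_1_eq)
  finally have "(?X - 1) ^ (p - 1) = (\<Sum>i<p. ?X ^ i)"
    using ne mult_left_cancel by blast
  then show "coeff ([:- 1, 1 :: 'k:] ^ (p - 1)) i = 1" if "i < p"
    unfolding X X_pow using that by (simp only: coeff_sum coeff_monom) simp
qed

lemma coprime_multiple_nat:
  assumes "prime (p :: nat)" "0 < d" "d < p"
  shows "\<exists>m k. d * m = p * k + 1"
proof -
  have "coprime d p"
    using assms by (metis coprime_commute nat_dvd_not_less prime_imp_coprime)
  then show ?thesis
    using bezout_nat[of d p] assms by auto
qed

text \<open>The parameter \<open>k_type\<close> carries the coefficient field as a type, which G, g
  and p do not mention. Natural powers of the generator exhaust the group, so its action is governed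
  by iterates of one map.\<close>

locale cyclic_group_alg =
  fixes G :: "('g, 'z) monoid_scheme" and g :: 'g and p :: nat and k_type :: "'k::field itself"
  assumes char: "CHAR('k) = p" and p_pos: "p > 0"
    and group: "group G" and gen_closed: "g \<in> carrier G"
    and carrier_eq: "carrier G = range (\<lambda>j::nat. g [^]\<^bsub>G\<^esub> j)"
    and gen_pow: "g [^]\<^bsub>G\<^esub> p = \<one>\<^bsub>G\<^esub>"
    and gen_ne: "g \<noteq> \<one>\<^bsub>G\<^esub>"
begin

lemma prime_p: "prime p"
  using char p_pos prime_CHAR_semidom[where 'a = 'k] by simp

lemma p_gt_1: "p > 1"
  using prime_p prime_gt_1_nat by blast

end

text \<open>The action of g - 1, a generator of the augmentation ideal when g generates the
  group.\<close>

definition gen_diff :: "'g \<Rightarrow> ('k, 'g, 'v::ab_group_add) kgmod \<Rightarrow> 'v \<Rightarrow> 'v"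
  where "gen_diff g M v = act M g v - v"

locale cyclic_group_module = cyclic_group_alg G g p k_type
  for G :: "('g, 'z) monoid_scheme" and g p and k_type :: "'k::field itself" +
  fixes M :: "('k, 'g, 'v::ab_group_add) kgmod"
  assumes kG_module: "kG_module G M"
begin

sublocale V: vector_space "scal M"
  using kG_module by (simp add: kG_module_def)

lemma subspace_carrier: "V.subspace (carrier M)"
  using kG_module by (simp add: kG_module_def)

lemma zero_carrier [simp]: "0 \<in> carrier M"
  and add_carrier [simp]: "v \<in> carrier M \<Longrightarrow> w \<in> carrier M \<Longrightarrow> v + w \<in> carrier M"
  and diff_carrier [simp]: "v \<in> carrier M \<Longrightarrow> w \<in> carrier M \<Longrightarrow> v - w \<in> carrier M"
  and scal_carrier [simp]: "v \<in> carrier M \<Longrightarrow> scal M c v \<in> carrier M"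
  and sum_carrier: "(\<And>i. i \<in> I \<Longrightarrow> f i \<in> carrier M) \<Longrightarrow> sum f I \<in> carrier M"
  using subspace_carrier
  by (auto simp: V.subspace_0 V.subspace_add V.subspace_diff V.subspace_scale V.subspace_sum)

lemma act_closed: "h \<in> carrier G \<Longrightarrow> v \<in> carrier M \<Longrightarrow> act M h v \<in> carrier M"
  and act_add: "h \<in> carrier G \<Longrightarrow> v \<in> carrier M \<Longrightarrow> w \<in> carrier M \<Longrightarrow>
    act M h (v + w) = act M h v + act M h w"
  and act_scal: "h \<in> carrier G \<Longrightarrow> v \<in> carrier M \<Longrightarrow> act M h (scal M c v) = scal M c (act M h v)"
  and act_one: "v \<in> carrier M \<Longrightarrow> act M \<one>\<^bsub>G\<^esub> v = v"
  and act_mult: "h \<in> carrier G \<Longrightarrow> h' \<in> carrier G \<Longrightarrow> v \<in> carrier M \<Longrightarrow>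
    act M (h \<otimes>\<^bsub>G\<^esub> h') v = act M h (act M h' v)"
  using kG_module by (simp_all add: kG_module_def)

lemma act_zero: "h \<in> carrier G \<Longrightarrow> act M h 0 = 0"
  using act_add[of h 0 0] by simp

lemma act_diff: "h \<in> carrier G \<Longrightarrow> v \<in> carrier M \<Longrightarrow> w \<in> carrier M \<Longrightarrow>
    act M h (v - w) = act M h v - act M h w"
  using act_add[of h "v - w" w] by simp

lemma act_sum: "h \<in> carrier G \<Longrightarrow> (\<And>i. i \<in> I \<Longrightarrow> f i \<in> carrier M) \<Longrightarrow>
    act M h (sum f I) = (\<Sum>i\<in>I. act M h (f i))"
  by (induction I rule: infinite_finite_induct) (simp_all add: act_zero act_add sum_carrier)

lemma act_pow: "v \<in> carrier M \<Longrightarrow> act M (g [^]\<^bsub>G\<^esub> (j::nat)) v = (act M g ^^ j) v"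
proof (induction j)
  case 0
  then show ?case using act_one group.is_monoid[OF group] by (simp add: monoid.nat_pow_0)
next
  case (Suc j)
  interpret group G by (rule group)
  have "act M (g [^]\<^bsub>G\<^esub> Suc j) v = act M (g \<otimes>\<^bsub>G\<^esub> g [^]\<^bsub>G\<^esub> j) v"
    using gen_closed by (simp only: nat_pow_Suc2)
  then show ?case
    using Suc gen_closed by (simp add: act_mult)
qed

lemma act_funpow_closed: "v \<in> carrier M \<Longrightarrow> (act M g ^^ j) v \<in> carrier M"
  by (induction j) (simp_all add: act_closed gen_closed)

lemma act_funpow_p: "v \<in> carrier M \<Longrightarrow> (act M g ^^ p) v = v"
  using act_pow[of v p] gen_pow act_one by simp

lemma act_funpow_eq: "v \<in> carrier M \<Longrightarrow> act M g v = v \<Longrightarrow> (act M g ^^ j) v = v"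
  by (induction j) simp_all

text \<open>The binomial expansion of (g - 1)^n. Its coefficients are read off from the polynomial
  (X - 1)^n, so that identities in k[X] carry over to the module.\<close>

lemma gen_diff_funpow:
  assumes "v \<in> carrier M"
  shows "(gen_diff g M ^^ n) v = (\<Sum>i\<le>n. scal M (coeff ([:- 1, 1:] ^ n) i) ((act M g ^^ i) v))"
proof (induction n)
  case 0
  then show ?case by simp
next
  case (Suc n)
  define q where "q = [:- 1, 1::'k:] ^ n"
  let ?A = "\<lambda>i. (act M g ^^ i) v"
  note [simp] = act_funpow_closed[OF assms] gen_closed
  \<comment> \<open>The degree bound makes the coefficient at n + 1 vanish, which lets the shifted
    sum end at n again.\<close>
  have deg: "degree q \<le> n"
    using degree_power_le[of "[:- 1, 1::'k:]" n] by (simp add: q_def)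
  have "(\<Sum>i\<le>Suc n. scal M (coeff ([:- 1, 1:] ^ Suc n) i) (?A i)) =
    scal M (- coeff q 0) v + (\<Sum>i\<le>n. scal M (coeff q i - coeff q (Suc i)) (?A (Suc i)))"
    by (subst sum.atMost_Suc_shift) (simp add: q_def[symmetric])
  also have "\<dots> = (\<Sum>i\<le>n. scal M (coeff q i) (?A (Suc i)))
      - (scal M (coeff q 0) v + (\<Sum>i\<le>n. scal M (coeff q (Suc i)) (?A (Suc i))))"
    by (simp only: V.scale_left_diff_distrib sum_subtractf V.scale_minus_left) (simp add: algebra_simps)
  also have "scal M (coeff q 0) v + (\<Sum>i\<le>n. scal M (coeff q (Suc i)) (?A (Suc i)))
    = (\<Sum>i\<le>Suc n. scal M (coeff q i) (?A i))"
    by (subst sum.atMost_Suc_shift) simp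
  also have "\<dots> = (\<Sum>i\<le>n. scal M (coeff q i) (?A i))"
    using deg by (simp add: coeff_eq_0)
  also have "(\<Sum>i\<le>n. scal M (coeff q i) (?A (Suc i))) = act M g (\<Sum>i\<le>n. scal M (coeff q i) (?A i))"
    by (simp add: act_sum act_scal)
  finally show ?case
    using Suc by (simp add: gen_diff_def q_def)
qed

sublocale X: nilpotent_group "carrier M" "gen_diff g M" p
proof
  fix v assume v: "v \<in> carrier M"
  have "(gen_diff g M ^^ p) v = (\<Sum>i\<le>p. scal M (if i = p then 1 else if i = 0 then -1 else 0) ((act M g ^^ i) v))"
    unfolding gen_diff_funpow[OF v]
    by (intro sum.cong refl) (simp add: coeff_linear_pow_char(1)[OF char p_pos])
  also have "\<dots> = (\<Sum>i\<in>{0, p}. scal M (if i = p then 1 else if i = 0 then -1 else 0) ((act M g ^^ i) v))"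
    by (intro sum.mono_neutral_right) auto
  also have "\<dots> = 0"
    using p_pos act_funpow_p[OF v] by simp
  finally show "(gen_diff g M ^^ p) v = 0" .
qed (simp_all add: gen_diff_def act_closed act_diff gen_closed)

text \<open>The norm element of the group algebra is a power of g - 1; sums over orbits of length p
  thus lie in the image of x^(p-1).\<close>

lemma norm_eq:
  assumes "v \<in> carrier M"
  shows "(gen_diff g M ^^ (p - 1)) v = (\<Sum>i<p. (act M g ^^ i) v)"
  unfolding gen_diff_funpow[OF assms] using p_pos
  by (intro sum.cong) (auto simp: coeff_linear_pow_char(2)[OF char p_pos, simplified])

lemma gen_diff_eq_0_iff: "gen_diff g M v = 0 \<longleftrightarrow> act M g v = v"
  by (simp add: gen_diff_def)

lemma gen_diff_scal: "v \<in> carrier M \<Longrightarrow> gen_diff g M (scal M c v) = scal M c (gen_diff g M v)"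
  by (simp add: gen_diff_def act_scal gen_closed V.scale_right_diff_distrib)

lemma gen_diff_funpow_scal:
  "v \<in> carrier M \<Longrightarrow> (gen_diff g M ^^ n) (scal M c v) = scal M c ((gen_diff g M ^^ n) v)"
  by (induction n) (simp_all add: gen_diff_scal)

section \<open>Orbits of the generator and fixed vectors of permutation modules\<close>

lemma act_inj:
  assumes "v \<in> carrier M" "w \<in> carrier M" "act M g v = act M g w"
  shows "v = w"
proof -
  have "(act M g ^^ (p - 1)) (act M g v) = (act M g ^^ (p - 1)) (act M g w)"
    using assms by simp
  then have "(act M g ^^ Suc (p - 1)) v = (act M g ^^ Suc (p - 1)) w"
    by (simp only: funpow_Suc_right o_apply)
  then show ?thesis
    using act_funpow_p assms p_pos by simp
qed

lemma orbit_inj: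
  assumes b: "b \<in> carrier M" and "act M g b \<noteq> b"
  shows "inj_on (\<lambda>i. (act M g ^^ i) b) {..<p}"
proof (rule linorder_inj_onI)
  fix i j assume ij: "i < j" "i \<in> {..<p}" "j \<in> {..<p}"
  show "(act M g ^^ i) b \<noteq> (act M g ^^ j) b"
  proof
    assume eq: "(act M g ^^ i) b = (act M g ^^ j) b"
    have "0 < j - i" "j - i < p" using ij by auto
    \<comment> \<open>A coincidence makes g^(j-i) fix b. As j - i is invertible modulo p, some power
      of g^(j-i) acts as g, and g would fix b.\<close>
    then obtain m k where m: "(j - i) * m = p * k + 1"
      using coprime_multiple_nat[OF prime_p] by blast
    have period: "(act M g ^^ (n * l)) b = b" if "(act M g ^^ n) b = b" for n l
      using that by (induction l) (simp_all add: funpow_add)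
    \<comment> \<open>Inserting a full period p allows g^i to be cancelled by applying g^(p-i), with
      natural exponents throughout.\<close>
    have "(act M g ^^ (j - i)) b = (act M g ^^ (j - i)) ((act M g ^^ p) b)"
      by (simp only: act_funpow_p[OF b])
    also have "\<dots> = (act M g ^^ (j - i + p)) b"
      by (simp only: funpow_add o_apply)
    also have "j - i + p = p - i + j"
      using ij by simp
    also have "(act M g ^^ (p - i + j)) b = (act M g ^^ (p - i)) ((act M g ^^ i) b)"
      by (simp only: funpow_add o_apply eq)
    also have "\<dots> = (act M g ^^ (p - i + i)) b"
      by (simp only: funpow_add o_apply)
    also have "\<dots> = b"
      using ij act_funpow_p[OF b] by simp
    finally have "(act M g ^^ (j - i)) b = b" .
    then have "(act M g ^^ (p * k + 1)) b = b"
      using period[of "j - i" m] m by simp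
    moreover have "(act M g ^^ (p * k + 1)) b = act M g b"
      using period[of p k] act_funpow_p[OF b] by simp
    ultimately show False using assms by simp
  qed
qed (auto simp: linear)

text \<open>Induction on the size of A: the orbit of a moved element is removed, and since the
  coefficient is constant on it, its contribution is a multiple of an orbit sum, hence a
  norm.\<close>

lemma fixed_combination:
  assumes "finite A" "A \<subseteq> carrier M" "act M g ` A \<subseteq> A" "\<And>b. b \<in> A \<Longrightarrow> c (act M g b) = c b"
  shows "\<exists>v\<in>carrier M. (\<Sum>b\<in>A. scal M (c b) b) =
    (\<Sum>b | b \<in> A \<and> act M g b = b. scal M (c b) b) + (gen_diff g M ^^ (p - 1)) v"
  using assms
proof (induction "card A" arbitrary: A rule: less_induct)
  case less
  show ?case
  proof (cases "\<forall>b\<in>A. act M g b = b")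
    case True
    then have "{b \<in> A. act M g b = b} = A" by auto
    then show ?thesis by (intro bexI[of _ 0]) simp_all
  next
    case False
    then obtain b where b: "b \<in> A" "act M g b \<noteq> b" by auto
    have bM: "b \<in> carrier M" using b less.prems by auto
    define Orb where "Orb = (\<lambda>i. (act M g ^^ i) b) ` {..<p}"
    have pow_A: "(act M g ^^ i) b \<in> A \<and> c ((act M g ^^ i) b) = c b" for i
      using b less.prems by (induction i) auto
    have Orb: "Orb \<subseteq> A" "b \<in> Orb" "finite Orb"
      using pow_A p_pos unfolding Orb_def by (auto intro: image_eqI[of _ _ 0])
    \<comment> \<open>Every element of the orbit has a predecessor in it; for b itself this is
      g^(p-1) b. With injectivity of g, the complement of the orbit is stable.\<close>
    have surj: "\<exists>b''\<in>Orb. b' = act M g b''" if b'Orb: "b' \<in> Orb" for b'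
    proof -
      obtain i where i: "i < p" "b' = (act M g ^^ i) b" using b'Orb by (auto simp: Orb_def)
      show ?thesis
      proof (cases i)
        case 0
        then have "b' = act M g ((act M g ^^ (p - 1)) b)"
          using i act_funpow_p[OF bM] p_pos by (cases p) simp_all
        then show ?thesis using p_pos by (auto simp: Orb_def)
      next
        case (Suc j)
        then show ?thesis using i by (auto simp: Orb_def intro!: bexI[of _ "(act M g ^^ j) b"])
      qed
    qed
    have stable: "act M g ` (A - Orb) \<subseteq> A - Orb"
    proof safe
      fix b' assume b': "b' \<in> A" "b' \<notin> Orb"
      then show "act M g b' \<in> A" using less.prems by auto
      assume "act M g b' \<in> Orb"
      then obtain b'' where "b'' \<in> Orb" "act M g b' = act M g b''" using surj by blast
      then show False using b' act_inj[of b' b''] Orb less.prems by blast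
    qed
    have "card (A - Orb) < card A"
      using Orb b less.prems by (intro psubset_card_mono) auto
    then obtain v where v: "v \<in> carrier M" "(\<Sum>b\<in>A - Orb. scal M (c b) b) =
      (\<Sum>b | b \<in> A - Orb \<and> act M g b = b. scal M (c b) b) + (gen_diff g M ^^ (p - 1)) v"
      using less.hyps[of "A - Orb"] less.prems stable by auto
    have not_fixed: "act M g b' \<noteq> b'" if b'Orb: "b' \<in> Orb" for b'
    proof
      assume eq: "act M g b' = b'"
      obtain i where i: "i < p" "b' = (act M g ^^ i) b" using b'Orb by (auto simp: Orb_def)
      have "(act M g ^^ i) (act M g b) = (act M g ^^ i) b"
        using eq i by (simp add: funpow_swap1)
      then have "(act M g ^^ (p - i + i)) (act M g b) = (act M g ^^ (p - i + i)) b"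
        by (simp only: funpow_add o_apply)
      then show False
        using b i act_funpow_p bM act_closed gen_closed by simp
    qed
    \<comment> \<open>The p iterates are distinct and share one coefficient, so their sum is the
      norm of that multiple of b.\<close>
    have "(\<Sum>b\<in>Orb. scal M (c b) b) = (\<Sum>i<p. scal M (c b) ((act M g ^^ i) b))"
      unfolding Orb_def by (subst sum.reindex[OF orbit_inj[OF bM b(2)]]) (simp add: pow_A)
    also have "\<dots> = (gen_diff g M ^^ (p - 1)) (scal M (c b) b)"
      using bM by (simp add: gen_diff_funpow_scal norm_eq[simplified] V.scale_sum_right)
    finally have "(\<Sum>b\<in>A. scal M (c b) b) =
      (\<Sum>b | b \<in> A - Orb \<and> act M g b = b. scal M (c b) b) + (gen_diff g M ^^ (p - 1)) (v + scal M (c b) b)"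
      using v bM sum.subset_diff[OF Orb(1), of "\<lambda>b. scal M (c b) b"] less.prems
      by (simp add: X.funpow_add_arg add.assoc)
    moreover have "{b \<in> A - Orb. act M g b = b} = {b \<in> A. act M g b = b}"
      using not_fixed by auto
    ultimately show ?thesis
      using v bM by (intro bexI[of _ "v + scal M (c b) b"]) simp_all
  qed
qed

text \<open>The group is finite, so the orbits of finitely many generators form a finite spanning
  set over the field.\<close>

lemma fg_imp_finite_span:
  assumes "fg_kG_module G M"
  obtains T where "finite T" "T \<subseteq> carrier M" "carrier M = V.span T"
proof -
  obtain S where S: "finite S" "S \<subseteq> carrier M"
    "carrier M = V.span {act M h s | h s. h \<in> carrier G \<and> s \<in> S}"
    using assms by (auto simp: fg_kG_module_def)
  have "finite (carrier G)" using kG_module by (simp add: kG_module_def)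
  then have "finite ((\<lambda>(h, s). act M h s) ` (carrier G \<times> S))" using S by auto
  moreover have "(\<lambda>(h, s). act M h s) ` (carrier G \<times> S) = {act M h s | h s. h \<in> carrier G \<and> s \<in> S}"
    by auto
  ultimately show ?thesis
    using S that act_closed by (metis (no_types, lifting) V.span_superset)
qed

lemma finite_span_imp_fg:
  assumes "finite T" "T \<subseteq> carrier M" "carrier M \<subseteq> V.span T"
  shows "fg_kG_module G M"
proof -
  have *: "T \<subseteq> {act M h s | h s. h \<in> carrier G \<and> s \<in> T}"
  proof
    fix t assume "t \<in> T"
    moreover have "\<one>\<^bsub>G\<^esub> \<in> carrier G"
      using group by (simp add: group.is_monoid monoid.one_closed)
    ultimately show "t \<in> {act M h s | h s. h \<in> carrier G \<and> s \<in> T}"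
      using assms(2) act_one[of t] by (auto intro!: exI[of _ "\<one>\<^bsub>G\<^esub>"] exI[of _ t])
  qed
  have "V.span {act M h s | h s. h \<in> carrier G \<and> s \<in> T} \<subseteq> carrier M"
    using assms act_closed by (intro V.span_minimal subspace_carrier) auto
  moreover have "carrier M \<subseteq> V.span {act M h s | h s. h \<in> carrier G \<and> s \<in> T}"
    using assms(3) V.span_mono[OF *] by auto
  ultimately show ?thesis
    unfolding fg_kG_module_def using kG_module assms by blast
qed

text \<open>Coordinates travel with the permuted basis. A fixed vector therefore has coordinates
  that are constant on orbits, and \<open>fixed_combination\<close> separates the fixed basis
  vectors from a norm.\<close>

lemma permutation_fixed:
  assumes "finite B" "B \<subseteq> carrier M" "V.independent B" "V.span B = carrier M"
    "act M g ` B \<subseteq> B"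
  shows representation_act: "u \<in> carrier M \<Longrightarrow> b \<in> B \<Longrightarrow>
      V.representation B (act M g u) (act M g b) = V.representation B u b"
    and "w \<in> carrier M \<Longrightarrow> gen_diff g M w = 0 \<Longrightarrow> \<exists>v\<in>carrier M.
      w = (\<Sum>b | b \<in> B \<and> act M g b = b. scal M (V.representation B w b) b) + (gen_diff g M ^^ (p - 1)) v"
proof -
  show rep: "V.representation B (act M g u) (act M g b) = V.representation B u b"
    if u: "u \<in> carrier M" and b: "b \<in> B" for u b
  proof -
    let ?r = "V.representation B u"
    have "u = (\<Sum>b\<in>B. scal M (?r b) b)"
      using V.sum_representation_eq[of B u B] assms u by simp
    then have "act M g u = act M g (\<Sum>b\<in>B. scal M (?r b) b)" by simp
    also have "\<dots> = (\<Sum>b\<in>B. scal M (?r b) (act M g b))"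
      using assms gen_closed by (subst act_sum) (auto simp: act_scal subset_iff)
    finally have eq: "act M g u = (\<Sum>b\<in>B. scal M (?r b) (act M g b))" .
    have "V.representation B (act M g u) (act M g b) =
        (\<Sum>b'\<in>B. V.representation B (scal M (?r b') (act M g b')) (act M g b))"
      unfolding eq using assms gen_closed
      by (subst V.representation_sum) (auto simp: act_closed subset_iff)
    also have "\<dots> = (\<Sum>b'\<in>B. if b' = b then ?r b' else 0)"
    proof (intro sum.cong refl)
      fix b' assume b': "b' \<in> B"
      then have "V.representation B (scal M (?r b') (act M g b')) (act M g b)
        = ?r b' * (if act M g b = act M g b' then 1 else 0)"
        using assms gen_closed
        by (subst V.representation_scale)
          (auto simp: act_closed V.representation_basis subset_iff image_subset_iff)
      then show "V.representation B (scal M (?r b') (act M g b')) (act M g b) = (if b' = b then ?r b' else 0)"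
        using act_inj[of b b'] b b' assms by auto
    qed
    also have "\<dots> = ?r b" using b assms by simp
    finally show ?thesis .
  qed
  assume w: "w \<in> carrier M" "gen_diff g M w = 0"
  then have "act M g w = w" by (simp add: gen_diff_eq_0_iff)
  then have "V.representation B w (act M g b) = V.representation B w b" if "b \<in> B" for b
    using rep[OF w(1) that] by simp
  then obtain v where "v \<in> carrier M" "(\<Sum>b\<in>B. scal M (V.representation B w b) b) =
      (\<Sum>b | b \<in> B \<and> act M g b = b. scal M (V.representation B w b) b) + (gen_diff g M ^^ (p - 1)) v"
    using fixed_combination[of B "V.representation B w"] assms by blast
  moreover have "(\<Sum>b\<in>B. scal M (V.representation B w b) b) = w"
    using V.sum_representation_eq[of B w B] assms w by simp
  ultimately show "\<exists>v\<in>carrier M. w =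
      (\<Sum>b | b \<in> B \<and> act M g b = b. scal M (V.representation B w b) b) + (gen_diff g M ^^ (p - 1)) v"
    by auto
qed

text \<open>If x^2 m = 0, then x m is fixed, hence a combination of fixed basis vectors plus a norm.
  At a fixed basis vector g m and m have equal coordinates, so the combination is zero.\<close>

lemma permutation_gap:
  assumes "permutation_module G M"
  shows "X.gap 1 0"
  unfolding X.gap_def
proof (intro ballI impI)
  obtain B where B: "B \<subseteq> carrier M" "V.independent B" "V.span B = carrier M"
    "act M g ` B \<subseteq> B"
    using assms gen_closed unfolding permutation_module_def by (meson image_subsetI)
  have "fg_kG_module G M"
    using assms by (simp add: permutation_module_def)
  then obtain T where "finite T" "T \<subseteq> carrier M" "carrier M = V.span T"
    by (rule fg_imp_finite_span)
  then have "finite B"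
    using V.independent_span_bound[of T B] B by auto
  note B = this B
  fix m assume m: "m \<in> carrier M" "(gen_diff g M ^^ Suc 1) m = 0"
  then obtain v where v: "v \<in> carrier M" "gen_diff g M m =
      (\<Sum>b | b \<in> B \<and> act M g b = b. scal M (V.representation B (gen_diff g M m) b) b) + (gen_diff g M ^^ (p - 1)) v"
    using permutation_fixed(2)[OF B, of "gen_diff g M m"] X.op_closed by auto
  have "V.representation B (gen_diff g M m) b = 0" if "b \<in> B" "act M g b = b" for b
    using permutation_fixed(1)[OF B m(1) that(1)] that m act_closed gen_closed B
    by (simp add: gen_diff_def V.representation_diff)
  then have "(\<Sum>b | b \<in> B \<and> act M g b = b. scal M (V.representation B (gen_diff g M m) b) b) = 0"
    by (intro sum.neutral) auto
  then show "\<exists>m'\<in>carrier M. (gen_diff g M ^^ 1) m = (gen_diff g M ^^ (p - 0 - 1)) m'"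
    using v by auto
qed

end

section \<open>Direct sums and direct summands\<close>

lemma kG_module_direct_sum:
  assumes "kG_module G M" "kG_module G N"
  shows "kG_module G (direct_sum M N)"
proof -
  interpret M: vector_space "scal M" using assms by (simp add: kG_module_def)
  interpret N: vector_space "scal N" using assms by (simp add: kG_module_def)
  interpret S: vector_space "scal (direct_sum M N)"
    by unfold_locales
      (auto simp: direct_sum_def M.scale_right_distrib N.scale_right_distrib
        M.scale_left_distrib N.scale_left_distrib)
  have sub: "S.subspace (carrier (direct_sum M N))"
    unfolding S.subspace_def using assms
    by (auto simp: kG_module_def M.subspace_def N.subspace_def direct_sum_def zero_prod_def)
  show ?thesis
    unfolding kG_module_def
    by (intro conjI sub S.vector_space_axioms)
      (use assms in \<open>auto simp: kG_module_def direct_sum_def\<close>)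
qed

context cyclic_group_alg
begin

abbreviation jordan_gap :: "('k, 'g, 'v::ab_group_add) kgmod \<Rightarrow> nat \<Rightarrow> nat \<Rightarrow> bool"
  where "jordan_gap M \<equiv> nilpotent_group.gap (carrier M) (gen_diff g M) p"

lemma cyclic_group_moduleI:
  fixes M :: "('k, 'g, 'v::ab_group_add) kgmod"
  assumes "kG_module G M"
  shows "cyclic_group_module G g p M"
  using assms by (intro cyclic_group_module.intro cyclic_group_alg_axioms cyclic_group_module_axioms.intro)

lemma jordan_gap_iff:
  fixes M :: "('k, 'g, 'v::ab_group_add) kgmod"
  assumes "kG_module G M"
  shows "jordan_gap M a b \<longleftrightarrow> (\<forall>m\<in>carrier M. (gen_diff g M ^^ Suc a) m = 0 \<longrightarrow>
    (\<exists>m'\<in>carrier M. (gen_diff g M ^^ a) m = (gen_diff g M ^^ (p - b - 1)) m'))"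
proof -
  interpret cyclic_group_module G g p k_type M by (rule cyclic_group_moduleI) fact
  show ?thesis by (rule X.gap_def)
qed

lemma jordan_gap_direct_sum:
  fixes M :: "('k, 'g, 'v::ab_group_add) kgmod" and N :: "('k, 'g, 'w::ab_group_add) kgmod"
  assumes "kG_module G M" "kG_module G N"
  shows "jordan_gap (direct_sum M N) a b \<longleftrightarrow> jordan_gap M a b \<and> jordan_gap N a b"
proof -
  interpret M: cyclic_group_module G g p k_type M by (rule cyclic_group_moduleI) fact
  interpret N: cyclic_group_module G g p k_type N by (rule cyclic_group_moduleI) fact
  have op: "(gen_diff g (direct_sum M N) ^^ n) (v, w) = ((gen_diff g M ^^ n) v, (gen_diff g N ^^ n) w)" for n v w
    by (induction n) (simp_all add: gen_diff_def direct_sum_def)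
  have carr: "carrier (direct_sum M N) = carrier M \<times> carrier N"
    by (simp add: direct_sum_def)
  note defs = jordan_gap_iff[OF kG_module_direct_sum[OF assms]] jordan_gap_iff[OF assms(1)] jordan_gap_iff[OF assms(2)]
  show ?thesis
  proof
    assume L: "jordan_gap (direct_sum M N) a b"
    show "jordan_gap M a b \<and> jordan_gap N a b"
      unfolding defs
    proof (intro conjI ballI impI)
      fix m assume "m \<in> carrier M" "(gen_diff g M ^^ Suc a) m = 0"
      then show "\<exists>m'\<in>carrier M. (gen_diff g M ^^ a) m = (gen_diff g M ^^ (p - b - 1)) m'"
        using bspec[OF L[unfolded defs, unfolded carr], of "(m, 0)", unfolded op]
        by (auto simp: zero_prod_def op simp del: funpow.simps)
    next
      fix m assume "m \<in> carrier N" "(gen_diff g N ^^ Suc a) m = 0"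
      then show "\<exists>m'\<in>carrier N. (gen_diff g N ^^ a) m = (gen_diff g N ^^ (p - b - 1)) m'"
        using bspec[OF L[unfolded defs, unfolded carr], of "(0, m)", unfolded op]
        by (auto simp: zero_prod_def op simp del: funpow.simps)
    qed
  next
    assume R: "jordan_gap M a b \<and> jordan_gap N a b"
    show "jordan_gap (direct_sum M N) a b"
      unfolding defs unfolding carr
    proof (intro ballI impI)
      fix m assume m: "m \<in> carrier M \<times> carrier N" "(gen_diff g (direct_sum M N) ^^ Suc a) m = 0"
      obtain u v where uv: "m = (u, v)" by (cases m)
      have "u \<in> carrier M" "v \<in> carrier N"
        "(gen_diff g M ^^ Suc a) u = 0" "(gen_diff g N ^^ Suc a) v = 0"
        using m unfolding uv op by (auto simp: zero_prod_def)
      then obtain u' v' where "u' \<in> carrier M" "(gen_diff g M ^^ a) u = (gen_diff g M ^^ (p - b - 1)) u'"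
        "v' \<in> carrier N" "(gen_diff g N ^^ a) v = (gen_diff g N ^^ (p - b - 1)) v'"
        using R unfolding defs by meson
      then show "\<exists>m'\<in>carrier M \<times> carrier N.
          (gen_diff g (direct_sum M N) ^^ a) m = (gen_diff g (direct_sum M N) ^^ (p - b - 1)) m'"
        by (intro bexI[of _ "(u', v')"]) (simp_all add: uv op)
    qed
  qed
qed

text \<open>A gap passes to direct summands, so the permutation module containing M suffices; no
  classification of its summands enters.\<close>

lemma p_permutation_gap:
  fixes M :: "('k, 'g, 'v::ab_group_add) kgmod"
  assumes "p_permutation_module G M"
  shows "jordan_gap M 1 0"
proof -
  obtain Q :: "('k, 'g) small_kgmod" where Q: "fg_kG_module G Q" "permutation_module G (direct_sum M Q)"
    using assms by (auto simp: p_permutation_module_def)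
  have M: "kG_module G M" using assms by (auto simp: p_permutation_module_def fg_kG_module_def)
  have Q': "kG_module G Q" using Q by (simp add: fg_kG_module_def)
  interpret S: cyclic_group_module G g p k_type "direct_sum M Q"
    by (intro cyclic_group_moduleI kG_module_direct_sum M Q')
  show ?thesis
    using S.permutation_gap[OF Q(2)] jordan_gap_direct_sum[OF M Q'] by blast
qed

end

section \<open>Resolutions impose gaps\<close>

lemma kG_module_diff_closed:
  assumes "kG_module G M"
  shows kG_module_zero: "0 \<in> carrier M"
    and "v \<in> carrier M \<Longrightarrow> w \<in> carrier M \<Longrightarrow> v - w \<in> carrier M"
proof -
  interpret vector_space "scal M" using assms by (simp add: kG_module_def)
  have "subspace (carrier M)" using assms by (simp add: kG_module_def)
  then show "0 \<in> carrier M" "v \<in> carrier M \<Longrightarrow> w \<in> carrier M \<Longrightarrow> v - w \<in> carrier M"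
    by (auto intro: subspace_0 subspace_diff)
qed

lemma kG_hom_diff:
  assumes "kG_module G M" "f \<in> kG_hom G M N" "v \<in> carrier M" "w \<in> carrier M"
  shows "f (v - w) = f v - f w"
proof -
  have "v - w \<in> carrier M"
    using assms kG_module_diff_closed(2) by blast
  then have "f (v - w + w) = f (v - w) + f w"
    using assms unfolding kG_hom_def by blast
  then show ?thesis by simp
qed

lemma kG_hom_zero: "kG_module G M \<Longrightarrow> f \<in> kG_hom G M N \<Longrightarrow> f 0 = 0"
  using kG_hom_diff[of G M f N 0 0] kG_module_zero by fastforce

lemma kG_module_subspace:
  assumes "kG_module G M" "A \<subseteq> carrier M" "module.subspace (scal M) A"
    "\<And>h v. h \<in> carrier G \<Longrightarrow> v \<in> A \<Longrightarrow> act M h v \<in> A"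
  shows "kG_module G (M\<lparr>carrier := A\<rparr>)"
  using assms unfolding kG_module_def by (auto simp: subset_iff)

lemma kG_module_kernel:
  assumes M: "kG_module G M" and N: "kG_module G N" and f: "f \<in> kG_hom G M N"
  shows "kG_module G (M\<lparr>carrier := {v \<in> carrier M. f v = 0}\<rparr>)"
proof (rule kG_module_subspace[OF M])
  interpret V: vector_space "scal M" using M by (simp add: kG_module_def)
  interpret W: vector_space "scal N" using N by (simp add: kG_module_def)
  have "V.subspace (carrier M)" using M by (simp add: kG_module_def)
  then show "V.subspace {v \<in> carrier M. f v = 0}"
    using kG_hom_zero[OF M f] f unfolding V.subspace_def by (auto simp: kG_hom_def)
  fix h v assume hv: "h \<in> carrier G" "v \<in> {v \<in> carrier M. f v = 0}"
  then have "act M h v \<in> carrier M" "f (act M h v) = act N h 0"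
    using M f by (auto simp: kG_module_def kG_hom_def)
  moreover have "act N h 0 = 0"
  proof -
    have "act N h (0 + 0) = act N h 0 + act N h 0"
      using N hv kG_module_zero[OF N] unfolding kG_module_def by blast
    then show ?thesis by simp
  qed
  ultimately show "act M h v \<in> {v \<in> carrier M. f v = 0}" by simp
qed auto

lemma p_permutation_kG_module: "p_permutation_module G M \<Longrightarrow> kG_module G M"
  by (simp add: p_permutation_module_def fg_kG_module_def)

lemma p_permutation_resolutionD:
  assumes "p_permutation_resolution G M s P d e"
  shows "p_permutation_module G (P i)" "i > s \<Longrightarrow> carrier (P i) = {0}"
    "d i \<in> kG_hom G (P (Suc i)) (P i)" "e \<in> kG_hom G (P 0) M" "e ` carrier (P 0) = carrier M"
    "{x \<in> carrier (P 0). e x = 0} = d 0 ` carrier (P 1)"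
    "{x \<in> carrier (P (Suc i)). d i x = 0} = d (Suc i) ` carrier (P (Suc (Suc i)))"
  using assms by (simp_all add: p_permutation_resolution_def)

text \<open>Dimension shifting: exactness at \<open>P 0\<close> turns \<open>d 0\<close> into an
  augmentation onto the kernel of \<open>e\<close>.\<close>

lemma resolution_kernel:
  assumes "p_permutation_resolution G M (Suc s) P d e"
  shows "p_permutation_resolution G ((P 0)\<lparr>carrier := {v \<in> carrier (P 0). e v = 0}\<rparr>) s
    (\<lambda>i. P (Suc i)) (\<lambda>i. d (Suc i)) (d 0)"
proof -
  note d = p_permutation_resolutionD(3)[OF assms] and im = p_permutation_resolutionD(6)[OF assms]
  have "d 0 \<in> kG_hom G (P (Suc 0)) ((P 0)\<lparr>carrier := {v \<in> carrier (P 0). e v = 0}\<rparr>)"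
    using d[of 0] unfolding im kG_hom_def by auto
  then show ?thesis
    using assms im unfolding p_permutation_resolution_def by auto
qed

text \<open>Splicing, the inverse of the shift: the augmentation \<open>e'\<close> onto the kernel
  becomes differential number 0 and all others move up by one.\<close>

lemma resolution_from_kernel:
  assumes "kG_module G M" "p_permutation_module G P0" "e \<in> kG_hom G P0 M" "e ` carrier P0 = carrier M"
    "p_permutation_resolution G (P0\<lparr>carrier := {v \<in> carrier P0. e v = 0}\<rparr>) s P d e'"
  shows "p_permutation_resolution G M (Suc s) (case_nat P0 P) (case_nat e' d) e"
proof -
  let ?K = "P0\<lparr>carrier := {v \<in> carrier P0. e v = 0}\<rparr>"
  have e': "e' \<in> kG_hom G (P 0) ?K" "e' ` carrier (P 0) = {v \<in> carrier P0. e v = 0}"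
    "{x \<in> carrier (P 0). e' x = 0} = d 0 ` carrier (P 1)"
    using assms(5) unfolding p_permutation_resolution_def by auto
  have "e' \<in> kG_hom G (P 0) P0"
    using e'(1) unfolding kG_hom_def by auto
  then show ?thesis
    using assms e' unfolding p_permutation_resolution_def
    by (auto split: nat.splits)
qed

context cyclic_group_alg
begin

lemma nilpotent_epiI:
  fixes M :: "('k, 'g, 'v::ab_group_add) kgmod" and P :: "('k, 'g, 'w::ab_group_add) kgmod"
  assumes M: "kG_module G M" and P: "kG_module G P" and gap: "jordan_gap P 1 0"
    and e: "e \<in> kG_hom G P M" "e ` carrier P = carrier M"
  shows "nilpotent_epi (carrier P) (gen_diff g P) (carrier M) (gen_diff g M) p e"
proof -
  interpret M: cyclic_group_module G g p k_type M by (rule cyclic_group_moduleI) fact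
  interpret P: cyclic_group_module G g p k_type P by (rule cyclic_group_moduleI) fact
  show ?thesis
  proof
    fix v assume "v \<in> carrier P"
    then show "e (gen_diff g P v) = gen_diff g M (e v)"
      using kG_hom_diff[OF P e(1)] e P.act_closed[OF gen_closed] gen_closed
      by (simp add: gen_diff_def kG_hom_def)
  qed (use assms kG_hom_diff[OF P e(1)] in auto)
qed

text \<open>Restricting the carrier leaves the action untouched, so the kernel as a subgroup and the
  kernel as a module have the same operator.\<close>

lemma jordan_gap_kernel:
  "nilpotent_group.gap {v \<in> carrier P. e v = 0} (gen_diff g P) p =
    jordan_gap (P\<lparr>carrier := {v \<in> carrier P. e v = 0}\<rparr>)"
  by (simp add: gen_diff_def[abs_def])

lemma gap_from_kernel:
  fixes M :: "('k, 'g, 'v::ab_group_add) kgmod" and P :: "('k, 'g, 'w::ab_group_add) kgmod"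
  assumes "kG_module G M" "p_permutation_module G P" "e \<in> kG_hom G P M" "e ` carrier P = carrier M"
    and "jordan_gap (P\<lparr>carrier := {v \<in> carrier P. e v = 0}\<rparr>) b (a - 1)" "a \<ge> 1"
  shows "jordan_gap M a b"
proof -
  interpret nilpotent_epi "carrier P" "gen_diff g P" "carrier M" "gen_diff g M" p e
    using assms by (intro nilpotent_epiI p_permutation_gap p_permutation_kG_module[of G P])
  show ?thesis
    using gap_from_kernel assms by (simp add: jordan_gap_kernel)
qed

text \<open>Since \<open>P 1\<close> is zero, the augmentation is bijective and carries the gap of
  \<open>P 0\<close> over to M.\<close>

lemma resolution_0_gap:
  fixes M :: "('k, 'g, 'v::ab_group_add) kgmod"
  assumes M: "kG_module G M" and res: "p_permutation_resolution G M 0 P d e"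
  shows "jordan_gap M 1 0"
proof -
  have perm: "p_permutation_module G (P 0)" and e: "e \<in> kG_hom G (P 0) M" "e ` carrier (P 0) = carrier M"
    using p_permutation_resolutionD[OF res] by blast+
  have P1: "kG_module G (P 1)" "carrier (P 1) = {0}" "d 0 \<in> kG_hom G (P 1) (P 0)"
    using p_permutation_resolutionD(2)[OF res, of 1] p_permutation_resolutionD(3)[OF res, of 0]
      p_permutation_kG_module[OF p_permutation_resolutionD(1)[OF res, of 1]] by simp_all
  have P0: "kG_module G (P 0)" using perm by (rule p_permutation_kG_module)
  have "{x \<in> carrier (P 0). e x = 0} = d 0 ` carrier (P 1)"
    by (rule p_permutation_resolutionD[OF res])
  then have ker: "{x \<in> carrier (P 0). e x = 0} = {0}"
    using P1 kG_hom_zero[OF P1(1,3)] by simp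
  interpret nilpotent_epi "carrier (P 0)" "gen_diff g (P 0)" "carrier M" "gen_diff g M" p e
    by (intro nilpotent_epiI M P0 e p_permutation_gap perm)
  show ?thesis
    unfolding M.gap_def
  proof (intro ballI impI)
    fix m assume m: "m \<in> carrier M" "(gen_diff g M ^^ Suc 1) m = 0"
    then obtain v where v: "v \<in> carrier (P 0)" "m = e v" using e by auto
    then have "e ((gen_diff g (P 0) ^^ Suc 1) v) = 0"
      using m by (simp only: hom_funpow)
    then have "(gen_diff g (P 0) ^^ Suc 1) v = 0"
      using ker v P.funpow_closed[of v "Suc 1"] by blast
    then obtain v' where "v' \<in> carrier (P 0)"
      "(gen_diff g (P 0) ^^ 1) v = (gen_diff g (P 0) ^^ (p - 0 - 1)) v'"
      using gap_P v unfolding P.gap_def by blast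
    then show "\<exists>m'\<in>carrier M. (gen_diff g M ^^ 1) m = (gen_diff g M ^^ (p - 0 - 1)) m'"
      using v by (metis hom_closed hom_funpow)
  qed
qed

text \<open>With a = (s + 1) div 2 + 1 and b = (s + 2) div 2, the pair (b, a - 1) is the one
  belonging to s. The kernel lives on the type of the resolving modules while M may live on any
  type, so this step is kept apart from the induction, which runs over modules on the former
  type.\<close>

lemma resolution_gap_step:
  fixes M :: "('k, 'g, 'v::ab_group_add) kgmod"
  assumes IH: "\<And>(K :: ('k, 'g) small_kgmod) P d e. kG_module G K \<Longrightarrow>
      p_permutation_resolution G K s P d e \<Longrightarrow> jordan_gap K (Suc (s div 2)) (Suc s div 2)"
    and M: "kG_module G M" and res: "p_permutation_resolution G M (Suc s) P d e"
  shows "jordan_gap M (Suc (Suc s div 2)) (Suc (Suc s) div 2)"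
proof -
  have P0: "p_permutation_module G (P 0)" and e: "e \<in> kG_hom G (P 0) M" "e ` carrier (P 0) = carrier M"
    using p_permutation_resolutionD[OF res] by blast+
  show ?thesis
    using IH[OF kG_module_kernel[OF p_permutation_kG_module[OF P0] M e(1)] resolution_kernel[OF res]]
    by (intro gap_from_kernel[OF M P0 e]) simp_all
qed

lemma resolution_small_gap:
  fixes K :: "('k, 'g) small_kgmod"
  assumes "kG_module G K" "p_permutation_resolution G K s P d e"
  shows "jordan_gap K (Suc (s div 2)) (Suc s div 2)"
  using assms
proof (induction s arbitrary: K P d e)
  case 0
  then show ?case using resolution_0_gap by simp
next
  case (Suc s)
  show ?case by (rule resolution_gap_step[OF Suc.IH Suc.prems])
qed

lemma resolution_gap:
  fixes M :: "('k, 'g, 'v::ab_group_add) kgmod"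
  assumes "kG_module G M" "p_permutation_resolution G M s P d e"
  shows "jordan_gap M (Suc (s div 2)) (Suc s div 2)"
proof (cases s)
  case 0
  then show ?thesis using resolution_0_gap assms by simp
next
  case (Suc n)
  show ?thesis
    unfolding Suc by (rule resolution_gap_step[OF resolution_small_gap]) (use assms Suc in auto)
qed

end

section \<open>Permutation modules on finitely supported sequences\<close>

text \<open>The underlying type is the one over which resolutions range, so that covers built from
  these modules can serve as their terms.\<close>

definition perm_kgmod :: "nat \<Rightarrow> ('g \<Rightarrow> nat \<Rightarrow> nat) \<Rightarrow> ('k::field, 'g) small_kgmod"
  where "perm_kgmod n \<alpha> =
    \<lparr>carrier = {f. Poly_Mapping.keys f \<subseteq> {..<n}},
     scal = (\<lambda>c. Poly_Mapping.map ((*) c)),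
     act = (\<lambda>h f. \<Sum>i<n. Poly_Mapping.single (\<alpha> h i) (Poly_Mapping.lookup f i))\<rparr>"

lemma lookup_scal_perm [simp]: "Poly_Mapping.lookup (scal (perm_kgmod n \<alpha>) c f) i = c * Poly_Mapping.lookup f i"
  unfolding perm_kgmod_def by (cases "Poly_Mapping.lookup f i = 0") (simp_all add: Poly_Mapping.map.rep_eq)

lemma carrier_perm: "f \<in> carrier (perm_kgmod n \<alpha>) \<longleftrightarrow> (\<forall>i\<ge>n. Poly_Mapping.lookup f i = 0)"
  unfolding perm_kgmod_def
  by (auto simp: subset_iff in_keys_iff not_le[symmetric])

lemma scal_single [simp]:
  "scal (perm_kgmod n \<alpha>) c (Poly_Mapping.single i a) = Poly_Mapping.single i (c * a)"
  by (rule poly_mapping_eqI) (simp add: lookup_single when_def)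

lemma vector_space_perm: "vector_space (scal (perm_kgmod n \<alpha>))"
  by unfold_locales (rule poly_mapping_eqI, simp add: lookup_add algebra_simps)+

lemma sum_single_perm:
  assumes "f \<in> carrier (perm_kgmod n \<alpha>)"
  shows "(\<Sum>i<n. Poly_Mapping.single i (Poly_Mapping.lookup f i)) = f"
proof (rule poly_mapping_eqI)
  fix j
  have "Poly_Mapping.lookup (\<Sum>i<n. Poly_Mapping.single i (Poly_Mapping.lookup f i)) j = (\<Sum>i<n. if i = j then Poly_Mapping.lookup f i else 0)"
    unfolding lookup_sum by (intro sum.cong) (auto simp: lookup_single)
  then show "Poly_Mapping.lookup (\<Sum>i<n. Poly_Mapping.single i (Poly_Mapping.lookup f i)) j = Poly_Mapping.lookup f j"
    using assms by (auto simp: carrier_perm not_less)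
qed

lemma single_carrier: "i < n \<Longrightarrow> Poly_Mapping.single i a \<in> carrier (perm_kgmod n \<alpha>)"
  by (simp add: carrier_perm lookup_single when_def)

lemma act_perm_eq:
  "act (perm_kgmod n \<alpha>) h f = (\<Sum>i<n. Poly_Mapping.single (\<alpha> h i) (Poly_Mapping.lookup f i))"
  by (simp add: perm_kgmod_def)

lemma act_perm_single:
  "i < n \<Longrightarrow> act (perm_kgmod n \<alpha>) h (Poly_Mapping.single i a) = Poly_Mapping.single (\<alpha> h i) a"
proof -
  assume "i < n"
  have "act (perm_kgmod n \<alpha>) h (Poly_Mapping.single i a) =
      (\<Sum>j<n. if j = i then Poly_Mapping.single (\<alpha> h i) a else 0)"
    unfolding act_perm_eq by (intro sum.cong) (auto simp: lookup_single)
  then show ?thesis using \<open>i < n\<close> by simp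
qed

lemma act_perm_add: "act (perm_kgmod n \<alpha>) h (f + f') = act (perm_kgmod n \<alpha>) h f + act (perm_kgmod n \<alpha>) h f'"
  by (simp add: perm_kgmod_def lookup_add single_add sum.distrib)

lemma act_perm_sum: "act (perm_kgmod n \<alpha>) h (sum f I) = (\<Sum>i\<in>I. act (perm_kgmod n \<alpha>) h (f i))"
proof -
  have "act (perm_kgmod n \<alpha>) h 0 = 0" by (simp add: perm_kgmod_def)
  then show ?thesis
    by (induction I rule: infinite_finite_induct) (simp_all add: act_perm_add)
qed

definition perm_basis :: "nat \<Rightarrow> (nat \<Rightarrow>\<^sub>0 'k::field) set"
  where "perm_basis n = (\<lambda>i. Poly_Mapping.single i 1) ` {..<n}"

lemma perm_basis_inj: "inj_on (\<lambda>i. Poly_Mapping.single i (1 :: 'k::field)) A"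
  by (intro inj_onI) (metis lookup_single_eq lookup_single_not_eq zero_neq_one)

locale perm_action =
  fixes G :: "('g, 'z) monoid_scheme" and n :: nat and \<alpha> :: "'g \<Rightarrow> nat \<Rightarrow> nat"
  assumes group: "group G" and finite_carrier: "finite (carrier G)"
    and perm_less: "h \<in> carrier G \<Longrightarrow> i < n \<Longrightarrow> \<alpha> h i < n"
    and perm_one: "i < n \<Longrightarrow> \<alpha> \<one>\<^bsub>G\<^esub> i = i"
    and perm_mult: "h \<in> carrier G \<Longrightarrow> h' \<in> carrier G \<Longrightarrow> i < n \<Longrightarrow> \<alpha> (h \<otimes>\<^bsub>G\<^esub> h') i = \<alpha> h (\<alpha> h' i)"
begin

abbreviation P :: "('k::field, 'g) small_kgmod"
  where "P \<equiv> perm_kgmod n \<alpha>"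

interpretation P: vector_space "scal (P :: ('k::field, 'g) small_kgmod)"
  by (rule vector_space_perm)

lemma subspace_perm: "P.subspace (carrier P)"
  by (auto simp: P.subspace_def carrier_perm lookup_add)

lemma kG_module_perm: "kG_module G (P :: ('k::field, 'g) small_kgmod)"
  unfolding kG_module_def
proof (intro conjI ballI allI)
  show "module.subspace (scal P) (carrier (P :: ('k, 'g) small_kgmod))" by (rule subspace_perm)
  fix h and v :: "nat \<Rightarrow>\<^sub>0 'k" assume h: "h \<in> carrier G" and v: "v \<in> carrier P"
  show "act P h v \<in> carrier P"
    unfolding act_perm_eq using h by (intro P.subspace_sum subspace_perm single_carrier perm_less) auto
  show "act P h (scal P c v) = scal P c (act P h v)" for c
    by (simp add: act_perm_eq P.scale_sum_right)
  fix h' assume h': "h' \<in> carrier G"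
  show "act P (h \<otimes>\<^bsub>G\<^esub> h') v = act P h (act P h' v)"
    unfolding act_perm_eq[of _ _ h'] act_perm_sum act_perm_eq[of _ _ "h \<otimes>\<^bsub>G\<^esub> h'"]
    using h h' by (intro sum.cong refl) (simp add: act_perm_single perm_less perm_mult)
next
  fix v :: "nat \<Rightarrow>\<^sub>0 'k" assume "v \<in> carrier P"
  then show "act P \<one>\<^bsub>G\<^esub> v = v"
    using sum_single_perm[of v n \<alpha>] by (simp add: act_perm_eq perm_one)
qed (simp_all add: group finite_carrier vector_space_perm act_perm_add)

lemma perm_basis:
  shows "finite (perm_basis n :: (nat \<Rightarrow>\<^sub>0 'k::field) set)" and "perm_basis n \<subseteq> carrier (P :: ('k, 'g) small_kgmod)"
    and "\<not> module.dependent (scal P) (perm_basis n :: (nat \<Rightarrow>\<^sub>0 'k) set)"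
    and "module.span (scal P) (perm_basis n) = carrier (P :: ('k, 'g) small_kgmod)"
    and "h \<in> carrier G \<Longrightarrow> act (P :: ('k, 'g) small_kgmod) h ` perm_basis n \<subseteq> perm_basis n"
proof -
  show fin: "finite (perm_basis n :: (nat \<Rightarrow>\<^sub>0 'k) set)" by (simp add: perm_basis_def)
  show sub: "perm_basis n \<subseteq> carrier (P :: ('k, 'g) small_kgmod)"
    by (auto simp: perm_basis_def intro: single_carrier)
  show "\<not> module.dependent (scal P) (perm_basis n :: (nat \<Rightarrow>\<^sub>0 'k) set)"
  proof (rule P.independent_if_scalars_zero[OF fin])
    fix c :: "(nat \<Rightarrow>\<^sub>0 'k) \<Rightarrow> 'k" and b :: "nat \<Rightarrow>\<^sub>0 'k"
    assume sum: "(\<Sum>b\<in>perm_basis n. scal P (c b) b) = 0" and "b \<in> perm_basis n"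
    then obtain j where j: "j < n" "b = Poly_Mapping.single j 1" by (auto simp: perm_basis_def)
    have "0 = Poly_Mapping.lookup (\<Sum>b\<in>perm_basis n. scal P (c b) b) j" using sum by simp
    also have "\<dots> = (\<Sum>i<n. if i = j then c b else 0)"
      unfolding perm_basis_def lookup_sum sum.reindex[OF perm_basis_inj]
      by (intro sum.cong) (auto simp: j lookup_single)
    finally show "c b = 0" using j by simp
  qed
  show "module.span (scal P) (perm_basis n) = carrier (P :: ('k, 'g) small_kgmod)"
  proof
    show "P.span (perm_basis n) \<subseteq> carrier (P :: ('k, 'g) small_kgmod)"
      by (intro P.span_minimal sub subspace_perm)
    show "carrier (P :: ('k, 'g) small_kgmod) \<subseteq> P.span (perm_basis n)"
    proof
      fix f :: "nat \<Rightarrow>\<^sub>0 'k" assume f: "f \<in> carrier P"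
      have "(\<Sum>i<n. scal P (Poly_Mapping.lookup f i) (Poly_Mapping.single i 1)) \<in> P.span (perm_basis n)"
        by (intro P.span_sum P.span_scale P.span_base) (simp add: perm_basis_def)
      then show "f \<in> P.span (perm_basis n)"
        using sum_single_perm[OF f] by simp
    qed
  qed
  show "act P h ` perm_basis n \<subseteq> (perm_basis n :: (nat \<Rightarrow>\<^sub>0 'k) set)" if "h \<in> carrier G"
    using perm_less[OF that] by (auto simp: perm_basis_def act_perm_single)
qed

end

context cyclic_group_alg
begin

lemma finite_carrier: "finite (carrier G)"
proof -
  have "g [^]\<^bsub>G\<^esub> j = g [^]\<^bsub>G\<^esub> (j mod p)" for j :: nat
  proof -
    interpret group G by (rule group)
    have "g [^]\<^bsub>G\<^esub> j = g [^]\<^bsub>G\<^esub> (p * (j div p) + j mod p)" by simp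
    also have "\<dots> = (g [^]\<^bsub>G\<^esub> p) [^]\<^bsub>G\<^esub> (j div p) \<otimes>\<^bsub>G\<^esub> g [^]\<^bsub>G\<^esub> (j mod p)"
      using gen_closed by (simp only: nat_pow_mult nat_pow_pow nat_pow_closed)
    finally show ?thesis using gen_pow gen_closed by simp
  qed
  then have "carrier G \<subseteq> (\<lambda>j::nat. g [^]\<^bsub>G\<^esub> j) ` {..<p}"
    unfolding carrier_eq using p_pos by (metis (mono_tags, lifting) image_iff image_subsetI lessThan_iff mod_less_divisor)
  then show ?thesis using finite_subset by blast
qed

text \<open>The empty set of indices yields the zero module, which serves as trivial complement and
  as the tail of resolutions.\<close>

lemma perm_zero_action: "perm_action G 0 \<alpha>"
  by (intro perm_action.intro group finite_carrier) auto

lemma permutation_imp_p_permutation: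
  fixes M :: "('k, 'g, 'v::ab_group_add) kgmod"
  assumes "permutation_module G M"
  shows "p_permutation_module G M"
proof -
  define Q :: "('k, 'g) small_kgmod" where "Q = perm_kgmod 0 (\<lambda>_ i. i)"
  interpret Q: perm_action G 0 "\<lambda>_ i. i" by (rule perm_zero_action)
  have Q: "kG_module G Q" unfolding Q_def by (rule Q.kG_module_perm)
  have Q0: "carrier Q = {0}"
    by (auto simp: Q_def carrier_perm intro: poly_mapping_eqI)
  have fg: "fg_kG_module G M" and M: "kG_module G M"
    using assms by (simp_all add: permutation_module_def fg_kG_module_def)
  interpret Q': cyclic_group_module G g p k_type Q by (rule cyclic_group_moduleI) fact
  interpret M: cyclic_group_module G g p k_type M by (rule cyclic_group_moduleI) fact
  interpret S: cyclic_group_module G g p k_type "direct_sum M Q"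
    by (intro cyclic_group_moduleI kG_module_direct_sum M Q)
  interpret i: module_hom "scal M" "scal (direct_sum M Q)" "\<lambda>v. (v, 0)"
    by unfold_locales (simp_all add: direct_sum_def)
  have carr: "carrier (direct_sum M Q) = (\<lambda>v. (v, 0)) ` carrier M"
    by (auto simp: direct_sum_def Q0)
  obtain B where B: "B \<subseteq> carrier M" "M.V.independent B" "M.V.span B = carrier M"
    "\<forall>h\<in>carrier G. \<forall>b\<in>B. act M h b \<in> B"
    using assms unfolding permutation_module_def by blast
  obtain T where T: "finite T" "T \<subseteq> carrier M" "carrier M = M.V.span T"
    by (rule M.fg_imp_finite_span[OF fg])
  have "fg_kG_module G (direct_sum M Q)"
    by (rule S.finite_span_imp_fg[of "(\<lambda>v. (v, 0)) ` T"])
      (use T in \<open>auto simp: carr i.span_image\<close>)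
  moreover have "S.V.independent ((\<lambda>v. (v, 0)) ` B)"
    by (rule i.independent_injective_image[OF B(2)]) (auto intro: inj_onI)
  moreover have "S.V.span ((\<lambda>v. (v, 0)) ` B) = carrier (direct_sum M Q)"
    by (simp add: i.span_image B(3) carr)
  moreover have "\<forall>h\<in>carrier G. \<forall>b\<in>(\<lambda>v. (v, 0)) ` B. act (direct_sum M Q) h b \<in> (\<lambda>v. (v, 0)) ` B"
    using B(4) by (auto simp: direct_sum_def Q'.act_zero)
  moreover have "(\<lambda>v. (v, 0)) ` B \<subseteq> carrier (direct_sum M Q)"
    using B(1) carr by auto
  ultimately have "permutation_module G (direct_sum M Q)"
    unfolding permutation_module_def by blast
  moreover have "fg_kG_module G Q"
    by (rule Q'.finite_span_imp_fg[of "{}"]) (simp_all add: Q0)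
  ultimately show ?thesis
    using fg unfolding p_permutation_module_def by blast
qed

lemma permutation_perm:
  assumes "perm_action G n \<alpha>"
  shows "permutation_module G (perm_kgmod n \<alpha> :: ('k, 'g) small_kgmod)"
proof -
  interpret perm_action G n \<alpha> by fact
  interpret cyclic_group_module G g p k_type "perm_kgmod n \<alpha> :: ('k, 'g) small_kgmod"
    by (intro cyclic_group_moduleI kG_module_perm)
  have "fg_kG_module G (perm_kgmod n \<alpha> :: ('k, 'g) small_kgmod)"
    using perm_basis[where 'k = 'k] by (intro finite_span_imp_fg[of "perm_basis n"]) simp_all
  moreover have "\<forall>h\<in>carrier G. \<forall>b\<in>perm_basis n. act P h b \<in> (perm_basis n :: (nat \<Rightarrow>\<^sub>0 'k) set)"
    using perm_basis(5)[where 'k = 'k] by blast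
  ultimately show ?thesis
    unfolding permutation_module_def using perm_basis[where 'k = 'k] by blast
qed

end

section \<open>Permutation covers\<close>

context cyclic_group_module
begin

lemma act_eq_if_fixed:
  assumes "v \<in> carrier M" "act M g v = v" "h \<in> carrier G"
  shows "act M h v = v"
  using assms act_pow act_funpow_eq unfolding carrier_eq by auto

text \<open>The norm annihilates g - 1, as x^(p-1) x = x^p = 0. Norms of basis vectors thus depend
  only on the orbit.\<close>

lemma norm_act:
  assumes u: "u \<in> carrier M" and "h \<in> carrier G"
  shows "(gen_diff g M ^^ (p - 1)) (act M h u) = (gen_diff g M ^^ (p - 1)) u"
proof -
  let ?N = "gen_diff g M ^^ (p - 1)"
  have step: "?N (act M g v) = ?N v" if v: "v \<in> carrier M" for v
  proof -
    have "?N (act M g v) - ?N v = ?N (gen_diff g M v)"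
      using v act_closed gen_closed by (simp add: gen_diff_def X.funpow_diff)
    also have "\<dots> = (gen_diff g M ^^ Suc (p - 1)) v"
      by (simp only: funpow_Suc_right o_apply)
    also have "\<dots> = 0" using v by (intro X.funpow_ge_nilpotent) auto
    finally show ?thesis by simp
  qed
  obtain j :: nat where "h = g [^]\<^bsub>G\<^esub> j" using assms carrier_eq by auto
  moreover have "?N ((act M g ^^ j) u) = ?N u"
    by (induction j) (simp_all add: step[simplified] act_funpow_closed u)
  ultimately show ?thesis using act_pow[OF u] by simp
qed

lemma finite_independent_subset:
  assumes "fg_kG_module G M" "V.independent A" "A \<subseteq> carrier M"
  shows "finite A"
proof -
  obtain T where "finite T" "T \<subseteq> carrier M" "carrier M = V.span T"
    by (rule fg_imp_finite_span[OF assms(1)])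
  then show ?thesis
    using V.independent_span_bound[of T A] assms by auto
qed

lemma subspace_funpow_image: "V.subspace ((gen_diff g M ^^ a) ` carrier M)"
  unfolding V.subspace_def
proof (intro conjI ballI allI)
  show "0 \<in> (gen_diff g M ^^ a) ` carrier M"
    by (rule image_eqI[of _ _ 0]) simp_all
  fix u assume "u \<in> (gen_diff g M ^^ a) ` carrier M"
  then obtain u' where u: "u' \<in> carrier M" "u = (gen_diff g M ^^ a) u'" by blast
  show "scal M c u \<in> (gen_diff g M ^^ a) ` carrier M" for c
    using u by (intro image_eqI[of _ _ "scal M c u'"]) (simp_all add: gen_diff_funpow_scal)
  fix v assume "v \<in> (gen_diff g M ^^ a) ` carrier M"
  then obtain v' where v: "v' \<in> carrier M" "v = (gen_diff g M ^^ a) v'" by blast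
  show "u + v \<in> (gen_diff g M ^^ a) ` carrier M"
    using u v by (intro image_eqI[of _ _ "u' + v'"]) (simp_all add: X.funpow_add_arg)
qed

lemma subspace_fixed: "V.subspace {v \<in> carrier M. gen_diff g M v = 0}"
  unfolding V.subspace_def
  using X.funpow_add_arg[of _ _ 1] X.funpow_zero[of 1] gen_diff_scal by auto

text \<open>A basis D of the fixed vectors inside x^a M is extended by C to a basis of all fixed
  vectors; C spans the complement on which the trivial part of a cover is built.\<close>

lemma fixed_points_basis:
  assumes fg: "fg_kG_module G M"
  obtains D C where "finite D" "finite C" "V.independent (D \<union> C)" "D \<inter> C = {}"
    "V.span D = {v \<in> carrier M. gen_diff g M v = 0} \<inter> (gen_diff g M ^^ a) ` carrier M"
    "V.span (D \<union> C) = {v \<in> carrier M. gen_diff g M v = 0}"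
proof -
  let ?K = "{v \<in> carrier M. gen_diff g M v = 0}"
  let ?I = "?K \<inter> (gen_diff g M ^^ a) ` carrier M"
  have I: "V.subspace ?I"
    by (intro V.subspace_inter subspace_fixed subspace_funpow_image)
  obtain D where D: "D \<subseteq> ?I" "V.independent D" "?I \<subseteq> V.span D"
    by (rule V.maximal_independent_subset)
  then have "D \<subseteq> ?K" by blast
  then obtain E where E: "D \<subseteq> E" "E \<subseteq> ?K" "V.independent E" "?K \<subseteq> V.span E"
    by (rule V.maximal_independent_subset_extend[OF _ D(2)])
  have "finite E" using finite_independent_subset[OF fg E(3)] E(2) by blast
  show ?thesis
  proof (rule that[of D "E - D"])
    show "finite D" "finite (E - D)"
      using \<open>finite E\<close> E(1) finite_subset by auto
    show "V.span D = ?I"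
      using V.span_minimal[OF D(1) I] D(3) by blast
    have "D \<union> (E - D) = E" using E(1) by blast
    then show "V.independent (D \<union> (E - D))" "V.span (D \<union> (E - D)) = ?K"
      using E V.span_minimal[OF E(2) subspace_fixed] by auto
  qed blast
qed

lemma independent_span_inter:
  assumes "V.independent (D \<union> C)" "D \<inter> C = {}" "s \<in> V.span D" "s \<in> V.span C"
  shows "s = 0"
proof -
  have "V.representation (D \<union> C) s = V.representation D s"
    "V.representation (D \<union> C) s = V.representation C s"
    using assms by (auto intro: V.representation_extend)
  then have "V.representation (D \<union> C) s b = 0" for b
    using V.representation_ne_zero[of D s b] V.representation_ne_zero[of C s b] assms(2) by auto
  moreover have "s \<in> V.span (D \<union> C)"
    using assms(3) V.span_mono[of D "D \<union> C"] by blast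
  ultimately show ?thesis
    using V.sum_nonzero_representation_eq[OF assms(1), of s] by simp
qed

end

text \<open>Data of a cover by a permutation module: the basis vector with index i goes to
  \<open>m i\<close>. Fixed indices form the trivial part and match C; each b in B is the image of
  the basis vector with index \<open>\<iota> b\<close>, and the orbits of these indices contain all
  moved ones.\<close>

locale permutation_cover =
  cyclic_group_module G g p k_type M + A: perm_action G n \<alpha>
  for G :: "('g, 'z) monoid_scheme" and g p and k_type :: "'k::field itself"
    and M :: "('k, 'g, 'v::ab_group_add) kgmod" and n \<alpha> +
  fixes m :: "nat \<Rightarrow> 'v" and B C :: "'v set" and \<iota> :: "'v \<Rightarrow> nat"
  assumes m_closed: "i < n \<Longrightarrow> m i \<in> carrier M"
    and m_equivariant: "h \<in> carrier G \<Longrightarrow> i < n \<Longrightarrow> m (\<alpha> h i) = act M h (m i)"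
    and m_fixed: "bij_betw m {i. i < n \<and> \<alpha> g i = i} C"
    and \<iota>_less: "b \<in> B \<Longrightarrow> \<iota> b < n" and m_\<iota>: "b \<in> B \<Longrightarrow> m (\<iota> b) = b"
    and moved_orbit: "i < n \<Longrightarrow> \<alpha> g i \<noteq> i \<Longrightarrow> \<exists>b\<in>B. \<exists>h\<in>carrier G. i = \<alpha> h (\<iota> b)"
begin

abbreviation Q :: "('k, 'g) small_kgmod"
  where "Q \<equiv> perm_kgmod n \<alpha>"

abbreviation basis_vec :: "nat \<Rightarrow> (nat \<Rightarrow>\<^sub>0 'k)"
  where "basis_vec i \<equiv> Poly_Mapping.single i 1"

sublocale Q: cyclic_group_module G g p k_type Q
  by (intro cyclic_group_moduleI A.kG_module_perm)

lemma p_permutation_Q: "p_permutation_module G Q"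
  by (intro permutation_imp_p_permutation permutation_perm A.perm_action_axioms)

definition eps :: "(nat \<Rightarrow>\<^sub>0 'k) \<Rightarrow> 'v"
  where "eps f = (\<Sum>i<n. scal M (Poly_Mapping.lookup f i) (m i))"

sublocale eps: module_hom "scal Q" "scal M" eps
  by unfold_locales
    (simp_all add: eps_def lookup_add V.scale_left_distrib sum.distrib V.scale_sum_right)

lemma eps_single: "i < n \<Longrightarrow> eps (Poly_Mapping.single i c) = scal M c (m i)"
proof -
  assume i: "i < n"
  have "eps (Poly_Mapping.single i c) = (\<Sum>j<n. if j = i then scal M c (m i) else 0)"
    unfolding eps_def by (intro sum.cong) (auto simp: lookup_single)
  then show ?thesis using i by simp
qed

lemma eps_hom: "eps \<in> kG_hom G Q M"
  unfolding kG_hom_def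
proof (intro CollectI conjI ballI allI)
  fix v assume v: "v \<in> carrier Q"
  show "eps v \<in> carrier M"
    unfolding eps_def by (intro sum_carrier scal_carrier m_closed) simp
  fix h assume h: "h \<in> carrier G"
  have "eps (act Q h v) = (\<Sum>i<n. eps (Poly_Mapping.single (\<alpha> h i) (Poly_Mapping.lookup v i)))"
    unfolding act_perm_eq by (rule eps.sum)
  also have "\<dots> = (\<Sum>i<n. scal M (Poly_Mapping.lookup v i) (act M h (m i)))"
    using h by (intro sum.cong refl) (simp add: eps_single A.perm_less m_equivariant)
  also have "\<dots> = act M h (eps v)"
    unfolding eps_def using h by (subst act_sum) (simp_all add: m_closed act_scal)
  finally show "eps (act Q h v) = act M h (eps v)" .
qed (simp_all add: eps.add eps.scale)

lemma eps_image: "eps ` carrier Q = V.span (m ` {..<n})"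
proof -
  have "eps ` carrier Q = V.span (eps ` perm_basis n)"
    unfolding eps.span_image A.perm_basis(4)[symmetric] ..
  also have "eps ` perm_basis n = m ` {..<n}"
    unfolding perm_basis_def image_image by (intro image_cong) (simp_all add: eps_single)
  finally show ?thesis .
qed

definition fixed_basis :: "(nat \<Rightarrow>\<^sub>0 'k) set"
  where "fixed_basis = basis_vec ` {i. i < n \<and> \<alpha> g i = i}"

lemma basis_vec_eq_iff: "basis_vec i = basis_vec j \<longleftrightarrow> i = j"
  using inj_onD[OF perm_basis_inj[of UNIV]] by auto

lemma fixed_basis_eq: "fixed_basis = {b \<in> perm_basis n. act Q g b = b}"
  unfolding fixed_basis_def perm_basis_def by (auto simp: act_perm_single basis_vec_eq_iff)

lemma fixed_basis_closed: "Q.V.span fixed_basis \<subseteq> {v \<in> carrier Q. gen_diff g Q v = 0}"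
  using A.perm_basis(2)[where 'k = 'k]
  by (intro Q.V.span_minimal Q.subspace_fixed) (auto simp: fixed_basis_eq Q.gen_diff_eq_0_iff)

lemma bij_eps_fixed_basis: "bij_betw eps fixed_basis C"
proof -
  have "inj_on basis_vec {i. i < n \<and> \<alpha> g i = i}" by (rule perm_basis_inj)
  then have "bij_betw basis_vec {i. i < n \<and> \<alpha> g i = i} fixed_basis"
    unfolding fixed_basis_def by (rule inj_on_imp_bij_betw)
  moreover have "bij_betw (eps \<circ> basis_vec) {i. i < n \<and> \<alpha> g i = i} C"
    using m_fixed by (rule bij_betw_cong[THEN iffD1, rotated]) (simp add: eps_single)
  ultimately show ?thesis
    using bij_betw_comp_iff by blast
qed

lemma eps_span_fixed_basis: "eps ` Q.V.span fixed_basis = V.span C"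
  using bij_betw_imp_surj_on[OF bij_eps_fixed_basis] by (simp flip: eps.span_image)

lemma fixed_decomposition:
  assumes w: "w \<in> carrier Q" "gen_diff g Q w = 0"
  obtains t v where "t \<in> Q.V.span fixed_basis" "v \<in> carrier Q" "w = t + (gen_diff g Q ^^ (p - 1)) v"
proof -
  obtain v where v: "v \<in> carrier Q" "w = (\<Sum>b | b \<in> perm_basis n \<and> act Q g b = b.
      scal Q (Q.V.representation (perm_basis n) w b) b) + (gen_diff g Q ^^ (p - 1)) v"
    using Q.permutation_fixed(2)[OF A.perm_basis(1-4) A.perm_basis(5)[OF gen_closed] w] by blast
  show ?thesis
  proof (rule that[OF _ v])
    show "(\<Sum>b | b \<in> perm_basis n \<and> act Q g b = b.
      scal Q (Q.V.representation (perm_basis n) w b) b) \<in> Q.V.span fixed_basis"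
      by (intro Q.V.span_sum Q.V.span_scale Q.V.span_base) (simp add: fixed_basis_eq)
  qed
qed

lemma eps_gen_diff: "v \<in> carrier Q \<Longrightarrow> eps (gen_diff g Q v) = gen_diff g M (eps v)"
  using eps_hom gen_closed unfolding kG_hom_def by (simp add: gen_diff_def eps.diff)

lemma eps_funpow: "v \<in> carrier Q \<Longrightarrow> eps ((gen_diff g Q ^^ j) v) = (gen_diff g M ^^ j) (eps v)"
  by (induction j) (simp_all add: eps_gen_diff)

lemma eps_closed: "v \<in> carrier Q \<Longrightarrow> eps v \<in> carrier M"
  using eps_hom by (simp add: kG_hom_def)

text \<open>The two conditions of \<open>gap_kernel\<close> are checked. Fixed vectors of the cover
  are combinations of fixed basis vectors plus norms, and the former map onto the span of C, which
  meets x^a M only in 0 and together with the span of D gives all fixed vectors of M.\<close>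

lemma kernel_jordan_gap:
  assumes surj: "eps ` carrier Q = carrier M"
    and fixed: "{v \<in> carrier M. gen_diff g M v = 0} =
      {d + c | d c. d \<in> V.span D \<and> c \<in> V.span C}"
    and D: "V.span D \<subseteq> (gen_diff g M ^^ a) ` carrier M"
    and disj: "\<And>s. s \<in> V.span C \<Longrightarrow> s \<in> (gen_diff g M ^^ a) ` carrier M \<Longrightarrow> s = 0"
    and "a \<ge> 1" "b \<ge> 1" "jordan_gap M a b"
  shows "jordan_gap (Q\<lparr>carrier := {v \<in> carrier Q. eps v = 0}\<rparr>) b (a - 1)"
proof -
  interpret e: nilpotent_epi "carrier Q" "gen_diff g Q" "carrier M" "gen_diff g M" p eps
    by (intro nilpotent_epiI kG_module Q.kG_module p_permutation_gap p_permutation_Q eps_hom surj)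
  have "e.K.gap b (a - 1)"
  proof (rule e.gap_kernel)
    fix r assume a: "a < p" and r: "r \<in> carrier Q" "gen_diff g Q r = 0"
      and er: "eps r \<in> (gen_diff g M ^^ a) ` carrier M"
    obtain t v where tv: "t \<in> Q.V.span fixed_basis" "v \<in> carrier Q"
      "r = t + (gen_diff g Q ^^ (p - 1)) v"
      by (rule fixed_decomposition[OF r])
    have et: "eps r = eps t + (gen_diff g M ^^ (p - 1)) (eps v)"
      using tv by (simp only: eps.add eps_funpow)
    obtain m' where m': "m' \<in> carrier M" "eps r = (gen_diff g M ^^ a) m'"
      using er by blast
    \<comment> \<open>As a \<le> p - 1, norms lie in x^a M, so \<open>eps t\<close> lies there too
      and must vanish.\<close>
    have "p - 1 = a + (p - 1 - a)" using a by simp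
    then have "eps t = (gen_diff g M ^^ a) (m' - (gen_diff g M ^^ (p - 1 - a)) (eps v))"
      using et m' tv(2) eps_closed
      by (metis X.funpow_closed X.funpow_diff X.funpow_funpow add_diff_cancel_right')
    moreover have "eps t \<in> V.span C"
      using tv(1) eps_span_fixed_basis by blast
    ultimately have "eps t = 0"
      using m' tv(2) eps_closed disj[of "eps t"] by simp
    then show "eps r \<in> (gen_diff g M ^^ (p - 1)) ` carrier M"
      using et tv eps_closed by simp
  next
    fix v assume "v \<in> carrier M" "gen_diff g M v = 0"
    then obtain d c where dc: "d \<in> V.span D" "c \<in> V.span C" "v = d + c"
      using fixed by blast
    then obtain t m' where "t \<in> Q.V.span fixed_basis" "c = eps t"
      "m' \<in> carrier M" "d = (gen_diff g M ^^ a) m'"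
      using D eps_span_fixed_basis by blast
    moreover from this have "t \<in> carrier Q" "gen_diff g Q t = 0"
      using fixed_basis_closed by blast+
    ultimately show "\<exists>r\<in>carrier Q. \<exists>m'\<in>carrier M. gen_diff g Q r = 0 \<and> v = eps r + (gen_diff g M ^^ a) m'"
      using dc(3) by (intro bexI[of _ t] bexI[of _ m']) (simp_all add: add.commute)
  qed fact+
  then show ?thesis by (simp add: jordan_gap_kernel)
qed

text \<open>The map is an isomorphism of socles: norms of the moved basis vectors go to D and fixed
  basis vectors go to C. Nilpotency of x extends injectivity from the socle to everything, and
  surjectivity follows by induction on the power of x killing a vector.\<close>

lemma eps_bij:
  assumes indep: "V.independent (D \<union> C)" and disj: "D \<inter> C = {}"
    and fixed: "V.span (D \<union> C) = {v \<in> carrier M. gen_diff g M v = 0}"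
    and D: "bij_betw (gen_diff g M ^^ (p - 1)) B D"
    and span_D: "V.span D = {v \<in> carrier M. gen_diff g M v = 0} \<inter> gen_diff g M ` carrier M"
  shows eps_onto: "eps ` carrier Q = carrier M"
    and eps_inj: "{v \<in> carrier Q. eps v = 0} = {0}"
proof -
  let ?y = "gen_diff g M" and ?x = "gen_diff g Q"
  define T where "T = (\<lambda>b. (?x ^^ (p - 1)) (basis_vec (\<iota> b))) ` B"
  have bv: "basis_vec i \<in> carrier Q" if "i < n" for i
    using that by (rule single_carrier)
  have eps_T: "eps ((?x ^^ (p - 1)) (basis_vec (\<iota> b))) = (?y ^^ (p - 1)) b" if "b \<in> B" for b
    using that bv[OF \<iota>_less[OF that]] by (simp add: eps_funpow eps_single \<iota>_less m_\<iota>)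
  have T_image: "eps ` T = D"
    unfolding T_def image_image using eps_T D by (auto simp: bij_betw_def)
  have T_sub: "T \<subseteq> (?x ^^ (p - 1)) ` carrier Q"
    unfolding T_def using bv \<iota>_less by auto
  have span_T: "Q.V.span T \<subseteq> (?x ^^ (p - 1)) ` carrier Q"
    by (intro Q.V.span_minimal T_sub Q.subspace_funpow_image)
  have eps_span_T: "V.span D = eps ` Q.V.span T"
    using T_image eps.span_image by blast
  \<comment> \<open>It is enough to treat basis vectors: fixed ones have norm 0, and a moved one has
    the same norm as the representative \<open>\<iota> b\<close> of its orbit.\<close>
  have norm_T: "(?x ^^ (p - 1)) v \<in> Q.V.span T" if "v \<in> carrier Q" for v
  proof -
    have "perm_basis n \<subseteq> {v \<in> carrier Q. (?x ^^ (p - 1)) v \<in> Q.V.span T}"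
    proof (unfold perm_basis_def, safe)
      fix i assume i: "i < n"
      show "basis_vec i \<in> carrier Q" using i by (rule bv)
      show "(?x ^^ (p - 1)) (basis_vec i) \<in> Q.V.span T"
      proof (cases "\<alpha> g i = i")
        case True
        then have "(?x ^^ 1) (basis_vec i) = 0"
          using i by (simp add: gen_diff_def act_perm_single)
        then have "(?x ^^ (p - 1)) (basis_vec i) = 0"
          using Q.X.funpow_eq_zero[OF bv[OF i], of 1 "p - 1"] p_gt_1 by simp
        then show ?thesis by (simp only: Q.V.span_zero)
      next
        case False
        then obtain b h where bh: "b \<in> B" "h \<in> carrier G" "i = \<alpha> h (\<iota> b)"
          using moved_orbit i by blast
        have "basis_vec i = act Q h (basis_vec (\<iota> b))"
          using bh \<iota>_less by (simp add: act_perm_single)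
        then have "(?x ^^ (p - 1)) (basis_vec i) = (?x ^^ (p - 1)) (basis_vec (\<iota> b))"
          using Q.norm_act[OF bv[OF \<iota>_less[OF bh(1)]] bh(2)] by simp
        then show ?thesis
          using bh(1) Q.V.span_base[of _ T] by (simp add: T_def)
      qed
    qed
    moreover have "Q.V.subspace {v \<in> carrier Q. (?x ^^ (p - 1)) v \<in> Q.V.span T}"
      unfolding Q.V.subspace_def
      by (auto simp del: Q.X.funpow_zero
          simp: Q.X.funpow_zero[simplified] Q.X.funpow_add_arg Q.gen_diff_funpow_scal
          Q.V.span_zero Q.V.span_add Q.V.span_scale)
    ultimately have "Q.V.span (perm_basis n) \<subseteq> {v \<in> carrier Q. (?x ^^ (p - 1)) v \<in> Q.V.span T}"
      by (rule Q.V.span_minimal)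
    then show ?thesis using that A.perm_basis(4)[where 'k = 'k] by blast
  qed
  have inj_T: "inj_on eps T"
  proof (rule inj_onI)
    fix t t' assume "t \<in> T" "t' \<in> T" and eq: "eps t = eps t'"
    then obtain b b' where "b \<in> B" "t = (?x ^^ (p - 1)) (basis_vec (\<iota> b))"
      "b' \<in> B" "t' = (?x ^^ (p - 1)) (basis_vec (\<iota> b'))"
      by (auto simp: T_def)
    moreover from this have "b = b'"
      using eq eps_T bij_betw_imp_inj_on[OF D] by (metis inj_onD)
    ultimately show "t = t'" by simp
  qed
  have "inj_on eps (T \<union> fixed_basis)"
    using inj_T bij_eps_fixed_basis T_image disj
    by (subst inj_on_Un) (auto simp: bij_betw_def)
  moreover have "eps ` (T \<union> fixed_basis) = D \<union> C"
    using T_image bij_eps_fixed_basis by (auto simp: bij_betw_def image_Un)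
  ultimately have inj: "inj_on eps (Q.V.span (T \<union> fixed_basis))"
    using indep by (intro eps.inj_on_span_independent_image) simp_all
  have kernel_fixed: "w = 0" if w: "w \<in> carrier Q" "?x w = 0" "eps w = 0" for w
  proof -
    obtain t v where tv: "t \<in> Q.V.span fixed_basis" "v \<in> carrier Q"
      "w = t + (?x ^^ (p - 1)) v"
      by (rule fixed_decomposition[OF w(1,2)])
    then have "w \<in> Q.V.span (T \<union> fixed_basis)"
      using norm_T[OF tv(2)] Q.V.span_mono[of T "T \<union> fixed_basis"]
        Q.V.span_mono[of fixed_basis "T \<union> fixed_basis"] by (auto intro!: Q.V.span_add)
    then show ?thesis
      using inj w(3) Q.V.span_zero eps.zero by (metis inj_onD)
  qed
  \<comment> \<open>The last nonzero iterate of a kernel vector would be a nonzero fixed vector of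
    the kernel.\<close>
  have kernel: "w = 0" if "w \<in> carrier Q" "eps w = 0" "(?x ^^ j) w = 0" for j w
    using that
  proof (induction j)
    case (Suc j)
    have "(?x ^^ j) w = 0"
      using Suc.prems by (intro kernel_fixed[of "(?x ^^ j) w"]) (simp_all add: eps_funpow)
    then show ?case using Suc by blast
  qed simp
  then show "{v \<in> carrier Q. eps v = 0} = {0}"
    using Q.X.op_nilpotent eps.zero by auto
  have W: "V.subspace (eps ` carrier Q)"
    unfolding eps_image by (rule V.subspace_span)
  have fixed_W: "v \<in> eps ` carrier Q" if "v \<in> carrier M" "?y v = 0" for v
  proof -
    have "v \<in> V.span (D \<union> C)" using fixed that by simp
    then obtain d c where dc: "d \<in> V.span D" "c \<in> V.span C" "v = d + c"
      unfolding V.span_Un by blast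
    have "d \<in> eps ` carrier Q"
      using dc(1) span_T eps_span_T Q.X.funpow_closed by blast
    moreover have "c \<in> eps ` carrier Q"
      using dc(2) fixed_basis_closed eps_span_fixed_basis by blast
    ultimately show ?thesis using dc(3) V.subspace_add[OF W] by simp
  qed
  have onto: "v \<in> eps ` carrier Q" if "j \<le> p" "v \<in> carrier M" "(?y ^^ j) v = 0" for j v
    using that
  proof (induction j arbitrary: v)
    case 0
    then show ?case using V.subspace_0[OF W] by simp
  next
    case (Suc j)
    show ?case
    proof (cases j)
      case 0
      then show ?thesis using fixed_W Suc.prems by simp
    next
      case (Suc i)
      \<comment> \<open>For positive j this vector is fixed and a multiple of x, hence the image of
        a norm.\<close>
      have "(?y ^^ j) v \<in> V.span D"
        unfolding span_D using Suc Suc.prems X.funpow_closed[of v j] by auto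
      then obtain w where w: "w \<in> carrier Q" "(?y ^^ j) v = eps ((?x ^^ (p - 1)) w)"
        using eps_span_T span_T by blast
      \<comment> \<open>Since j \<le> p - 1, the norm x^(p-1) w equals x^j w', so subtracting the
        image of w' makes v vanish under x^j.\<close>
      define w' where "w' = (?x ^^ (p - 1 - j)) w"
      have w': "w' \<in> carrier Q" using w by (simp add: w'_def)
      have "(?y ^^ j) v = (?y ^^ j) (eps w')"
        using w Suc.prems by (simp add: w'_def eps_funpow[symmetric] Q.X.funpow_funpow)
      then have "(?y ^^ j) (v - eps w') = 0"
        using Suc.prems w' eps_closed by (simp add: X.funpow_diff)
      then have "v - eps w' \<in> eps ` carrier Q"
        using Suc.IH[of "v - eps w'"] Suc.prems w' eps_closed by simp
      then show ?thesis
        using V.subspace_add[OF W, of "v - eps w'" "eps w'"] w' by simp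
    qed
  qed
  show "eps ` carrier Q = carrier M"
    using onto[of p] eps_closed X.op_nilpotent by blast
qed

end

context cyclic_group_module
begin

text \<open>The underlying G-set is \<open>Y\<close>, the disjoint union of B copies of the regular
  G-set and of C with trivial action. It is numbered by f, along which the action is transported to
  the numbers below \<open>card Y\<close>.\<close>

lemma permutation_cover_exists:
  assumes B: "finite B" "B \<subseteq> carrier M" and C: "finite C" "C \<subseteq> carrier M"
    and C_fixed: "\<And>c. c \<in> C \<Longrightarrow> gen_diff g M c = 0"
  obtains n \<alpha> m \<iota> where "permutation_cover G g p M n \<alpha> m B C \<iota>"
proof -
  interpret grp: group G by (rule group)
  define Y where "Y = (B \<times> carrier G) <+> C"
  define \<beta> where "\<beta> = (\<lambda>k y. case y of Inl (b, k') \<Rightarrow> Inl (b :: 'v, k \<otimes>\<^bsub>G\<^esub> k') | Inr c \<Rightarrow> Inr (c :: 'v))"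
  define \<mu> where "\<mu> = (\<lambda>y. case y of Inl (b, k) \<Rightarrow> act M k b | Inr c \<Rightarrow> c)"
  have "finite Y" using B C finite_carrier by (simp add: Y_def)
  then obtain f where f: "bij_betw f {..<card Y} Y"
    using ex_bij_betw_nat_finite by (metis atLeast0LessThan)
  define f' where "f' = inv_into {..<card Y} f"
  have f_mem: "f i \<in> Y" "f' (f i) = i" if "i < card Y" for i
    using that f unfolding f'_def by (auto simp: bij_betw_def)
  have f'_mem: "f' y < card Y" "f (f' y) = y" if "y \<in> Y" for y
    using that f inv_into_into[of y f "{..<card Y}"] unfolding f'_def
    by (auto simp: bij_betw_def f_inv_into_f)
  have \<beta>_mem: "\<beta> k y \<in> Y" if "k \<in> carrier G" "y \<in> Y" for k y
    using that by (auto simp: \<beta>_def Y_def)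
  \<comment> \<open>Left multiplication by g has no fixed point because g is not the identity; the
    fixed points are exactly those from C.\<close>
  have \<beta>_fixed: "\<beta> g y = y \<longleftrightarrow> y \<in> Inr ` C" if "y \<in> Y" for y
    using that gen_ne gen_closed by (auto simp: \<beta>_def Y_def grp.r_cancel_one)
  define \<alpha> where "\<alpha> = (\<lambda>k i. f' (\<beta> k (f i)))"
  have fixed_iff: "\<alpha> g i = i \<longleftrightarrow> f i \<in> Inr ` C" if "i < card Y" for i
    using that f_mem f'_mem \<beta>_mem[OF gen_closed] \<beta>_fixed unfolding \<alpha>_def by metis
  define \<iota> where "\<iota> = (\<lambda>b. f' (Inl (b, \<one>\<^bsub>G\<^esub>)))"
  have Inl_mem: "Inl (b, k) \<in> Y" if "b \<in> B" "k \<in> carrier G" for b k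
    using that by (auto simp: Y_def)
  have "permutation_cover G g p M (card Y) \<alpha> (\<lambda>i. \<mu> (f i)) B C \<iota>"
  proof (intro permutation_cover.intro cyclic_group_module_axioms perm_action.intro
      permutation_cover_axioms.intro group finite_carrier)
    fix h i assume h: "h \<in> carrier G" and i: "i < card Y"
    show "\<alpha> h i < card Y"
      unfolding \<alpha>_def by (intro f'_mem \<beta>_mem f_mem h i)
    have "\<mu> (\<beta> h y) = act M h (\<mu> y)" if "y \<in> Y" for y
      using that h B C C_fixed
      by (auto simp: Y_def \<beta>_def \<mu>_def act_mult gen_diff_eq_0_iff intro!: act_eq_if_fixed[symmetric])
    then show "\<mu> (f (\<alpha> h i)) = act M h (\<mu> (f i))"
      unfolding \<alpha>_def using f'_mem \<beta>_mem f_mem h i by simp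
    fix h' assume h': "h' \<in> carrier G"
    have "\<beta> (h \<otimes>\<^bsub>G\<^esub> h') y = \<beta> h (\<beta> h' y)" if "y \<in> Y" for y
      using that h h' by (auto simp: Y_def \<beta>_def grp.m_assoc)
    then show "\<alpha> (h \<otimes>\<^bsub>G\<^esub> h') i = \<alpha> h (\<alpha> h' i)"
      unfolding \<alpha>_def using f'_mem \<beta>_mem f_mem h h' i by simp
  next
    fix i assume i: "i < card Y"
    have "\<beta> \<one>\<^bsub>G\<^esub> y = y" if "y \<in> Y" for y
      using that by (auto simp: Y_def \<beta>_def)
    then show "\<alpha> \<one>\<^bsub>G\<^esub> i = i"
      unfolding \<alpha>_def using f_mem i by simp
    have "\<mu> y \<in> carrier M" if "y \<in> Y" for y
      using that B C act_closed by (auto simp: Y_def \<mu>_def)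
    then show "\<mu> (f i) \<in> carrier M" using f_mem i by simp
    assume "\<alpha> g i \<noteq> i"
    then have "f i \<in> Y - Inr ` C" using fixed_iff i f_mem by auto
    then obtain b k where bk: "b \<in> B" "k \<in> carrier G" "f i = Inl (b, k)"
      by (auto simp: Y_def)
    have "\<alpha> k (\<iota> b) = f' (\<beta> k (Inl (b, \<one>\<^bsub>G\<^esub>)))"
      unfolding \<alpha>_def \<iota>_def using f'_mem Inl_mem bk by simp
    also have "\<dots> = i"
      using bk f_mem[OF i] by (simp add: \<beta>_def flip: bk(3))
    finally show "\<exists>b\<in>B. \<exists>h\<in>carrier G. i = \<alpha> h (\<iota> b)"
      using bk by blast
  next
    fix b assume b: "b \<in> B"
    show "\<iota> b < card Y" "\<mu> (f (\<iota> b)) = b"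
      unfolding \<iota>_def using f'_mem[OF Inl_mem[OF b]] b B act_one by (auto simp: \<mu>_def)
  next
    have "{i. i < card Y \<and> \<alpha> g i = i} = {i \<in> {..<card Y}. f i \<in> Inr ` C}"
      using fixed_iff by auto
    moreover have "bij_betw f {i \<in> {..<card Y}. f i \<in> Inr ` C} (Inr ` C)"
    proof (rule bij_betw_subset[OF f])
      have "Inr ` C \<subseteq> f ` {..<card Y}"
        using bij_betw_imp_surj_on[OF f] by (auto simp: Y_def)
      moreover have "f ` {i \<in> {..<card Y}. f i \<in> Inr ` C} = f ` {..<card Y} \<inter> Inr ` C"
        by auto
      ultimately show "f ` {i \<in> {..<card Y}. f i \<in> Inr ` C} = Inr ` C" by blast
    qed auto
    moreover have "bij_betw \<mu> (Inr ` C) C"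
      by (auto simp: bij_betw_def inj_on_def \<mu>_def image_image)
    ultimately show "bij_betw (\<lambda>i. \<mu> (f i)) {i. i < card Y \<and> \<alpha> g i = i} C"
      using bij_betw_trans[of f _ "Inr ` C" \<mu> C] by (simp add: o_def)
  qed
  then show ?thesis by (rule that)
qed

end

section \<open>Gaps yield resolutions\<close>

lemma zero_kG_hom:
  assumes "kG_module G M" "kG_module G N" "carrier M = {0}"
  shows "(\<lambda>_. 0) \<in> kG_hom G M N"
proof -
  interpret N: vector_space "scal N" using assms(2) by (simp add: kG_module_def)
  have "act N h 0 = 0" if "h \<in> carrier G" for h
  proof -
    have "act N h (0 + 0) = act N h 0 + act N h 0"
      using assms(2) that kG_module_zero[OF assms(2)] unfolding kG_module_def by blast
    then show ?thesis by simp
  qed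
  then show ?thesis
    using kG_module_zero[OF assms(2)] by (simp add: kG_hom_def)
qed

lemma p_permutation_resolution_mono:
  "p_permutation_resolution G M s P d e \<Longrightarrow> s \<le> s' \<Longrightarrow> p_permutation_resolution G M s' P d e"
  by (simp add: p_permutation_resolution_def)

text \<open>A finite infimum of lengths is attained, and a resolution of some length also counts as
  one of any greater length, being zero beyond.\<close>

lemma ppdim_le_iff: "ppdim G M \<le> enat s \<longleftrightarrow> (\<exists>P d e. p_permutation_resolution G M s P d e)"
proof
  assume "ppdim G M \<le> enat s"
  then have "Inf {enat s | s. \<exists>P d e. p_permutation_resolution G M s P d e} < enat (Suc s)"
    unfolding ppdim_def by (rule order.strict_trans1) simp
  then obtain s' where "enat s' < enat (Suc s)" "\<exists>P d e. p_permutation_resolution G M s' P d e"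
    unfolding Inf_less_iff by blast
  then show "\<exists>P d e. p_permutation_resolution G M s P d e"
    using p_permutation_resolution_mono by (metis enat_ord_simps(2) less_Suc_eq_le)
next
  assume "\<exists>P d e. p_permutation_resolution G M s P d e"
  then show "ppdim G M \<le> enat s"
    unfolding ppdim_def by (intro Inf_lower) blast
qed

context cyclic_group_module
begin

text \<open>The free part, on a finite spanning set T, gives surjectivity; the trivial part on C
  provides the fixed vectors required for the gap of the kernel.\<close>

lemma cover_with_gap_kernel:
  assumes fg: "fg_kG_module G M" and "a \<ge> 1" "b \<ge> 1" "jordan_gap M a b"
  shows "\<exists>(Q :: ('k, 'g) small_kgmod) e. p_permutation_module G Q \<and> e \<in> kG_hom G Q M \<and>
    e ` carrier Q = carrier M \<and> fg_kG_module G (Q\<lparr>carrier := {v \<in> carrier Q. e v = 0}\<rparr>) \<and>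
    jordan_gap (Q\<lparr>carrier := {v \<in> carrier Q. e v = 0}\<rparr>) b (a - 1)"
proof -
  obtain D C where DC: "finite D" "finite C" "V.independent (D \<union> C)" "D \<inter> C = {}"
    "V.span D = {v \<in> carrier M. gen_diff g M v = 0} \<inter> (gen_diff g M ^^ a) ` carrier M"
    "V.span (D \<union> C) = {v \<in> carrier M. gen_diff g M v = 0}"
    by (rule fixed_points_basis[OF fg])
  obtain T where T: "finite T" "T \<subseteq> carrier M" "carrier M = V.span T"
    by (rule fg_imp_finite_span[OF fg])
  have C_span: "V.span C \<subseteq> {v \<in> carrier M. gen_diff g M v = 0}"
    using DC(6) V.span_mono[of C "D \<union> C"] by blast
  then have C: "C \<subseteq> carrier M" "\<And>c. c \<in> C \<Longrightarrow> gen_diff g M c = 0"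
    using V.span_superset[of C] by blast+
  obtain n \<alpha> m \<iota> where "permutation_cover G g p M n \<alpha> m T C \<iota>"
    by (rule permutation_cover_exists[OF T(1,2) DC(2) C])
  then interpret permutation_cover G g p k_type M n \<alpha> m T C \<iota> .
  have "T \<subseteq> m ` {..<n}"
    using m_\<iota> \<iota>_less by (metis image_eqI lessThan_iff subsetI)
  then have surj: "eps ` carrier Q = carrier M"
    using V.span_mono[of T "m ` {..<n}"] T(3) eps_closed eps_image by blast
  let ?K = "Q\<lparr>carrier := {v \<in> carrier Q. eps v = 0}\<rparr>"
  interpret K: cyclic_group_module G g p k_type ?K
    by (intro cyclic_group_moduleI kG_module_kernel[OF Q.kG_module kG_module eps_hom])
  have fg_Q: "fg_kG_module G Q"
    using p_permutation_Q by (simp add: p_permutation_module_def)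
  \<comment> \<open>The kernel is finitely generated because it is a subspace of a
    finite-dimensional space.\<close>
  obtain S where S: "S \<subseteq> {v \<in> carrier Q. eps v = 0}" "Q.V.independent S"
    "{v \<in> carrier Q. eps v = 0} \<subseteq> Q.V.span S"
    by (rule Q.V.maximal_independent_subset)
  have "fg_kG_module G ?K"
    using S Q.finite_independent_subset[OF fg_Q S(2)]
    by (intro K.finite_span_imp_fg[of S]) auto
  moreover have "jordan_gap ?K b (a - 1)"
  proof (rule kernel_jordan_gap[OF surj _ _ _ assms(2-4)])
    show "{v \<in> carrier M. gen_diff g M v = 0} = {d + c | d c. d \<in> V.span D \<and> c \<in> V.span C}"
      unfolding DC(6)[symmetric] by (rule V.span_Un)
    show "V.span D \<subseteq> (gen_diff g M ^^ a) ` carrier M" using DC(5) by blast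
    fix s assume s: "s \<in> V.span C" "s \<in> (gen_diff g M ^^ a) ` carrier M"
    then have "s \<in> V.span D" using C_span DC(5) by blast
    then show "s = 0" using independent_span_inter[OF DC(3,4)] s(1) by blast
  qed
  ultimately show ?thesis
    using p_permutation_Q eps_hom surj by blast
qed

text \<open>For \<open>gap 1 0\<close>, each fixed vector in the image of x is a norm. Hence D has
  preimages B under the norm, and taking one free summand for each yields an isomorphism.\<close>

lemma cover_bijective:
  assumes fg: "fg_kG_module G M" and gap: "jordan_gap M 1 0"
  shows "\<exists>(Q :: ('k, 'g) small_kgmod) e. p_permutation_module G Q \<and> e \<in> kG_hom G Q M \<and>
    e ` carrier Q = carrier M \<and> {v \<in> carrier Q. e v = 0} = {0}"
proof -
  let ?y = "gen_diff g M"
  obtain D C where DC: "finite D" "finite C" "V.independent (D \<union> C)" "D \<inter> C = {}"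
    "V.span D = {v \<in> carrier M. ?y v = 0} \<inter> (?y ^^ 1) ` carrier M"
    "V.span (D \<union> C) = {v \<in> carrier M. ?y v = 0}"
    by (rule fixed_points_basis[OF fg])
  have C: "C \<subseteq> carrier M" "\<And>c. c \<in> C \<Longrightarrow> ?y c = 0"
    using DC(6) V.span_superset[of "D \<union> C"] by blast+
  have D: "D \<subseteq> (?y ^^ (p - 1)) ` carrier M"
  proof
    fix d assume "d \<in> D"
    then have "d \<in> V.span D" by (rule V.span_base)
    then obtain u where u: "u \<in> carrier M" "d = (?y ^^ 1) u" "?y d = 0"
      unfolding DC(5) by blast
    then have "(?y ^^ Suc 1) u = 0" by simp
    then show "d \<in> (?y ^^ (p - 1)) ` carrier M"
      using gap u unfolding X.gap_def by auto
  qed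
  then obtain B where B: "B \<subseteq> carrier M" "bij_betw (?y ^^ (p - 1)) B D"
    unfolding subset_image_inj bij_betw_def by blast
  then have "finite B" using DC(1) bij_betw_finite by blast
  then obtain n \<alpha> m \<iota> where "permutation_cover G g p M n \<alpha> m B C \<iota>"
    using permutation_cover_exists B(1) DC(2) C by metis
  then interpret permutation_cover G g p k_type M n \<alpha> m B C \<iota> .
  show ?thesis
    using eps_onto[OF DC(3,4,6) B(2)] eps_inj[OF DC(3,4,6) B(2)] DC(5) p_permutation_Q eps_hom
    by auto
qed

lemma gap_resolution_0:
  assumes "fg_kG_module G M" "jordan_gap M 1 0"
  shows "\<exists>P d e. p_permutation_resolution G M 0 P d e"
proof -
  obtain Q :: "('k, 'g) small_kgmod" and e where Q: "p_permutation_module G Q" "e \<in> kG_hom G Q M"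
    "e ` carrier Q = carrier M" "{v \<in> carrier Q. e v = 0} = {0}"
    using cover_bijective[OF assms] by blast
  define Z :: "('k, 'g) small_kgmod" where "Z = perm_kgmod 0 (\<lambda>_ i. i)"
  have Z: "p_permutation_module G Z"
    unfolding Z_def by (intro permutation_imp_p_permutation permutation_perm perm_zero_action)
  have Z0: "carrier Z = {0}"
    by (auto simp: Z_def carrier_perm intro: poly_mapping_eqI)
  have "(\<lambda>_. 0) \<in> kG_hom G Z Z" "(\<lambda>_. 0) \<in> kG_hom G Z Q"
    using Z0 p_permutation_kG_module Z Q(1) by (blast intro: zero_kG_hom)+
  then have "p_permutation_resolution G M 0 (case_nat Q (\<lambda>_. Z)) (\<lambda>_ _. 0) e"
    unfolding p_permutation_resolution_def
  proof (intro conjI allI impI)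
    fix i
    show "p_permutation_module G (case i of 0 \<Rightarrow> Q | Suc _ \<Rightarrow> Z)"
      using Q Z by (cases i) simp_all
    show "carrier (case i of 0 \<Rightarrow> Q | Suc _ \<Rightarrow> Z) = {0}" if "i > 0"
      using Z0 that by (cases i) simp_all
    show "(\<lambda>_. 0) \<in> kG_hom G (case Suc i of 0 \<Rightarrow> Q | Suc _ \<Rightarrow> Z) (case i of 0 \<Rightarrow> Q | Suc _ \<Rightarrow> Z)"
      using \<open>(\<lambda>_. 0) \<in> kG_hom G Z Z\<close> \<open>(\<lambda>_. 0) \<in> kG_hom G Z Q\<close> by (cases i) simp_all
  qed (use Q Z0 in simp_all)
  then show ?thesis by blast
qed

text \<open>One cover is chosen and the resolution of its kernel is spliced on. As before, the
  hypothesis concerns modules on the type of the resolving modules, whereas M is arbitrary.\<close>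

lemma gap_resolution_step:
  assumes IH: "\<And>K :: ('k, 'g) small_kgmod. fg_kG_module G K \<Longrightarrow>
      jordan_gap K (Suc (s div 2)) (Suc s div 2) \<Longrightarrow> \<exists>P d e. p_permutation_resolution G K s P d e"
    and "fg_kG_module G M" "jordan_gap M (Suc (Suc s div 2)) (Suc (Suc s) div 2)"
  shows "\<exists>P d e. p_permutation_resolution G M (Suc s) P d e"
proof -
  obtain Q :: "('k, 'g) small_kgmod" and e where Q: "p_permutation_module G Q" "e \<in> kG_hom G Q M"
    "e ` carrier Q = carrier M" "fg_kG_module G (Q\<lparr>carrier := {v \<in> carrier Q. e v = 0}\<rparr>)"
    "jordan_gap (Q\<lparr>carrier := {v \<in> carrier Q. e v = 0}\<rparr>) (Suc (Suc s) div 2) (Suc (Suc s div 2) - 1)"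
    using cover_with_gap_kernel[OF assms(2) _ _ assms(3)] by auto
  then show ?thesis
    using IH[OF Q(4)] resolution_from_kernel[OF kG_module Q(1-3)] by fastforce
qed

end

section \<open>Resolution length in terms of gaps, and additivity\<close>

context cyclic_group_alg
begin

lemma fg_kG_module_direct_sum:
  fixes M :: "('k, 'g, 'v::ab_group_add) kgmod" and N :: "('k, 'g, 'w::ab_group_add) kgmod"
  assumes fg_M: "fg_kG_module G M" and fg_N: "fg_kG_module G N"
  shows "fg_kG_module G (direct_sum M N)"
proof -
  have MN: "kG_module G M" "kG_module G N" using assms by (simp_all add: fg_kG_module_def)
  interpret M: cyclic_group_module G g p k_type M by (intro cyclic_group_moduleI MN)
  interpret N: cyclic_group_module G g p k_type N by (intro cyclic_group_moduleI MN)
  interpret S: cyclic_group_module G g p k_type "direct_sum M N"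
    by (intro cyclic_group_moduleI kG_module_direct_sum MN)
  interpret i: module_hom "scal M" "scal (direct_sum M N)" "\<lambda>v. (v, 0)"
    by unfold_locales (simp_all add: direct_sum_def)
  interpret j: module_hom "scal N" "scal (direct_sum M N)" "\<lambda>w. (0, w)"
    by unfold_locales (simp_all add: direct_sum_def)
  obtain T where T: "finite T" "T \<subseteq> carrier M" "carrier M = M.V.span T"
    by (rule M.fg_imp_finite_span[OF fg_M])
  obtain U where U: "finite U" "U \<subseteq> carrier N" "carrier N = N.V.span U"
    by (rule N.fg_imp_finite_span[OF fg_N])
  let ?B = "(\<lambda>v. (v, 0)) ` T \<union> (\<lambda>w. (0, w)) ` U"
  have "z \<in> S.V.span ?B" if z_mem: "z \<in> carrier (direct_sum M N)" for z
  proof -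
    obtain v w where z: "z = (v, 0) + (0, w)" "v \<in> carrier M" "w \<in> carrier N"
      using z_mem by (cases z) (auto simp: direct_sum_def)
    then show ?thesis
      unfolding S.V.span_Un i.span_image j.span_image T(3) U(3) by blast
  qed
  then show ?thesis
    using T U by (intro S.finite_span_imp_fg[of ?B]) (auto simp: direct_sum_def)
qed

lemma gap_resolution_small:
  fixes K :: "('k, 'g) small_kgmod"
  assumes "fg_kG_module G K" "jordan_gap K (Suc (s div 2)) (Suc s div 2)"
  shows "\<exists>P d e. p_permutation_resolution G K s P d e"
  using assms
proof (induction s arbitrary: K)
  case 0
  interpret cyclic_group_module G g p k_type K
    using 0 by (intro cyclic_group_moduleI) (simp add: fg_kG_module_def)
  show ?case using gap_resolution_0 0 by simp
next
  case (Suc s)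
  interpret cyclic_group_module G g p k_type K
    using Suc.prems by (intro cyclic_group_moduleI) (simp add: fg_kG_module_def)
  show ?case by (rule gap_resolution_step[OF Suc.IH Suc.prems])
qed

lemma ppdim_le_iff_gap:
  fixes M :: "('k, 'g, 'v::ab_group_add) kgmod"
  assumes fg: "fg_kG_module G M"
  shows "ppdim G M \<le> enat s \<longleftrightarrow> jordan_gap M (Suc (s div 2)) (Suc s div 2)"
proof -
  have M: "kG_module G M" using fg by (simp add: fg_kG_module_def)
  interpret cyclic_group_module G g p k_type M by (rule cyclic_group_moduleI[OF M])
  have "\<exists>P d e. p_permutation_resolution G M s P d e" if gap: "jordan_gap M (Suc (s div 2)) (Suc s div 2)"
  proof (cases s)
    case 0
    then show ?thesis using gap_resolution_0[OF fg] gap by simp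
  next
    case (Suc n)
    show ?thesis
      unfolding Suc using gap Suc by (intro gap_resolution_step gap_resolution_small fg) auto
  qed
  then show ?thesis
    unfolding ppdim_le_iff using resolution_gap[OF M] by blast
qed

end

theorem corollary3p9:
  fixes G :: "('g, 'z) monoid_scheme"
    and M :: "('k::field, 'g, 'm::ab_group_add) kgmod"
    and N :: "('k, 'g, 'n::ab_group_add) kgmod"
    and p :: nat
  assumes "CHAR('k) = p" and "p > 0"
    and "group G" and "cyclic_group G" and "Coset.order G = p"
    and "fg_kG_module G M" and "fg_kG_module G N"
  shows "ppdim G (direct_sum M N) = max (ppdim G M) (ppdim G N)"
proof -
  interpret group G by fact
  have "prime p" using assms prime_CHAR_semidom[where 'a = 'k] by simp
  obtain g where g: "g \<in> carrier G" "subgroup_generated G {g} = G"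
    using assms(4) by (auto simp: cyclic_group_def)
  have fin: "finite (carrier G)"
    using assms(6) by (simp add: fg_kG_module_def kG_module_def)
  have "carrier G = generate G {g}"
    using g carrier_subgroup_generated[of G "{g}"] by simp
  then have carr: "carrier G = range (\<lambda>j::nat. g [^]\<^bsub>G\<^esub> j)"
    \<comment> \<open>In a finite group, the natural powers of a generator already give the whole
      subgroup.\<close>
    using generate_pow_on_finite_carrier[OF fin g(1)] by auto
  have "g \<noteq> \<one>\<^bsub>G\<^esub>"
  proof
    assume "g = \<one>\<^bsub>G\<^esub>"
    then have "carrier G = {\<one>\<^bsub>G\<^esub>}" using carr by auto
    then show False
      using assms(5) prime_gt_1_nat[OF \<open>prime p\<close>] by (simp add: Coset.order_def)
  qed
  then interpret cyclic_group_alg G g p "TYPE('k)"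
    using assms g carr pow_order_eq_1[OF g(1)] by unfold_locales auto
  have "ppdim G (direct_sum M N) \<le> enat s \<longleftrightarrow> max (ppdim G M) (ppdim G N) \<le> enat s" for s
    using assms(6,7) jordan_gap_direct_sum[of M N]
    by (simp add: ppdim_le_iff_gap fg_kG_module_direct_sum) (simp add: fg_kG_module_def)
  \<comment> \<open>An extended natural number is determined by its finite upper bounds, infinity
    being the one without any.\<close>
  moreover have "x = y" if "\<And>s. x \<le> enat s \<longleftrightarrow> y \<le> enat s" for x y :: enat
    using that[of "the_enat x"] that[of "the_enat y"] by (cases x; cases y) auto
  ultimately show ?thesis by blast
qed

end
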